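(* The $k$-densest subgraph problem on planar graphs can be reduced in polynomial time to a network interdiction problem on a planar interdiction network with multiple sources and sinks and polynomially bounded input numbers.
   Context: The $k$-densest subgraph problem: given an undirected graph $G=(V,E)$ and an integer $k$, find a subgraph on $k$ vertices with a maximum number of edges. An interdiction network with multiple sources and sinks is $G=(V,E,u,S,T,c,d)$ where $(V,E)$ is a directed graph, $u(e)\in\{0,1,2,\dots\}$ are arc capacities, $S,T\subset V$ with $S\cap T=\emptyset$ are the sources and sinks, $d:V\to\mathbb{Z}\cup\{\pm\infty\}$ is a supply/demand function with $d(s)<0$ for $s\in S$, $d(t)>0$ for $t\in T$ and $d(v)=0$ otherwise, and every vertex and arc $p$ carries an interdiction cost $c(p)\in\{1,2,3,\dots\}\cup\{\infty\}$. A flow must respect the arc capacities and flow conservation at vertices outside $S\cup T$; each source $s$ may send at most $-d(s)$ net units and each sink $t$ may receive at most $d(t)$ net units; its value is the total amount received by the sinks. The network interdiction problem: given a budget $B\in\{0,1,2,\dots\}$, find a set $R\subset V\cup E$ with $c(R)=\sum_{r\in R}c(r)\le B$ minimizing the maximum flow value in $G\setminus R$ (the network obtained by deleting the arcs in $R$ and the vertices in $R$ together with their incident arcs). The network is planar if its underlying graph is planar. *)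

theory Defs
  imports
    "HOL-Analysis.Analysis"
    "HOL-Computational_Algebra.Polynomial"
    "HOL-Library.Extended_Nat"
    "HOL-Library.Extended"
begin

no_notation Pinf (\<open>\<infinity>\<close>)
no_notation Minf (\<open>-\<infinity>\<close>)

section \<open>Polynomial time\<close>

text \<open>
  The machine model is the imperative WHILE language over binary trees of N. D. Jones
  (Computability and Complexity from a Programming Perspective, 1997).  Values are measured as
  trees without sharing, and every read of a variable is charged the full size of its value.
  Hence all values produced in time \<open>t\<close> have size at most \<open>t\<close> plus the size of the input, each
  step can be simulated on a Turing machine in time polynomial in its charge, and conversely one
  step of a Turing machine with half-tapes stored as lists costs linearly in the tape length.  So
  polynomial time here is the usual polynomial time.
\<close>

datatype data = Leaf | Node data data

primrec data_size :: "data \<Rightarrow> nat" where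
  "data_size Leaf = 1"
| "data_size (Node a b) = 1 + data_size a + data_size b"

primrec data_hd :: "data \<Rightarrow> data" where
  "data_hd Leaf = Leaf"
| "data_hd (Node a b) = a"

primrec data_tl :: "data \<Rightarrow> data" where
  "data_tl Leaf = Leaf"
| "data_tl (Node a b) = b"

definition data_of_bool :: "bool \<Rightarrow> data" where
  "data_of_bool b = (if b then Node Leaf Leaf else Leaf)"

datatype expr =
    Var nat
  | Const_Leaf
  | Cons expr expr
  | Hd expr
  | Tl expr
  | Eq expr expr

datatype cmd =
    Assign nat expr
  | Seq cmd cmd
  | If expr cmd cmd
  | While expr cmd

type_synonym store = "nat \<Rightarrow> data"

primrec expr_val :: "expr \<Rightarrow> store \<Rightarrow> data" where
  "expr_val (Var x) s = s x"
| "expr_val Const_Leaf s = Leaf"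
| "expr_val (Cons a b) s = Node (expr_val a s) (expr_val b s)"
| "expr_val (Hd a) s = data_hd (expr_val a s)"
| "expr_val (Tl a) s = data_tl (expr_val a s)"
| "expr_val (Eq a b) s = data_of_bool (expr_val a s = expr_val b s)"

primrec expr_time :: "expr \<Rightarrow> store \<Rightarrow> nat" where
  "expr_time (Var x) s = data_size (s x)"
| "expr_time Const_Leaf s = 1"
| "expr_time (Cons a b) s = 1 + expr_time a s + expr_time b s"
| "expr_time (Hd a) s = 1 + expr_time a s"
| "expr_time (Tl a) s = 1 + expr_time a s"
| "expr_time (Eq a b) s = 1 + expr_time a s + expr_time b s"

text \<open>\<open>exec c s t s'\<close>: started in store \<open>s\<close>, the command \<open>c\<close> terminates in store \<open>s'\<close> after
  exactly \<open>t\<close> time units.  \<open>Leaf\<close> is falsity, every other value is truth.\<close>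

inductive exec :: "cmd \<Rightarrow> store \<Rightarrow> nat \<Rightarrow> store \<Rightarrow> bool" where
  Assign: "exec (Assign x e) s (1 + expr_time e s) (s(x := expr_val e s))"
| Seq: "exec c1 s t1 s' \<Longrightarrow> exec c2 s' t2 s'' \<Longrightarrow> exec (Seq c1 c2) s (1 + t1 + t2) s''"
| IfTrue: "expr_val e s \<noteq> Leaf \<Longrightarrow> exec c1 s t s'
    \<Longrightarrow> exec (If e c1 c2) s (1 + expr_time e s + t) s'"
| IfFalse: "expr_val e s = Leaf \<Longrightarrow> exec c2 s t s'
    \<Longrightarrow> exec (If e c1 c2) s (1 + expr_time e s + t) s'"
| WhileFalse: "expr_val e s = Leaf \<Longrightarrow> exec (While e c) s (1 + expr_time e s) s"
| WhileTrue: "expr_val e s \<noteq> Leaf \<Longrightarrow> exec c s t1 s' \<Longrightarrow> exec (While e c) s' t2 s''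
    \<Longrightarrow> exec (While e c) s (1 + expr_time e s + t1 + t2) s''"

definition computes_in :: "cmd \<Rightarrow> data \<Rightarrow> nat \<Rightarrow> data \<Rightarrow> bool" where
  "computes_in c x t y \<longleftrightarrow> (\<exists>s. exec c ((\<lambda>_. Leaf)(0 := x)) t s \<and> s 0 = y)"

lemma data_size_expr_val: "data_size (expr_val e s) \<le> expr_time e s"
proof (induction e)
  case (Hd e)
  then show ?case by (cases "expr_val e s") auto
next
  case (Tl e)
  then show ?case by (cases "expr_val e s") auto
next
  case (Eq a b)
  have "1 \<le> data_size x" for x by (cases x) auto
  from this[of "expr_val a s"] this[of "expr_val b s"] Eq show ?case
    by (auto simp: data_of_bool_def)
qed auto

lemma exec_deterministic:
  "exec c s t s' \<Longrightarrow> exec c s t' s'' \<Longrightarrow> t' = t \<and> s'' = s'"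
proof (induction arbitrary: t' s'' rule: exec.induct)
  case (Assign x e s)
  from Assign.prems show ?case by cases auto
next
  case (Seq c1 s t1 s1 c2 t2 s2)
  from Seq.prems show ?case by cases (use Seq.IH in blast)
next
  case (IfTrue e s c1 t s1 c2)
  from IfTrue.prems show ?case by cases (use IfTrue in blast)+
next
  case (IfFalse e s c2 t s1 c1)
  from IfFalse.prems show ?case by cases (use IfFalse in blast)+
next
  case (WhileFalse e s c)
  from WhileFalse.prems show ?case by cases (use WhileFalse in auto)
next
  case (WhileTrue e s c t1 s1 t2 s2)
  from WhileTrue.prems show ?case by cases (use WhileTrue in blast)+
qed


section \<open>Representing mathematical objects as data\<close>

text \<open>Numbers are written in binary, least significant bit first, without leading zeros.  Finite
  sets are represented by an arbitrary duplicate-free listing, so that a representation is a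
  relation rather than a function.\<close>

fun data_of_nat :: "nat \<Rightarrow> data" where
  "data_of_nat n = (if n = 0 then Leaf else Node (data_of_bool (odd n)) (data_of_nat (n div 2)))"

declare data_of_nat.simps [simp del]

primrec data_of_list :: "data list \<Rightarrow> data" where
  "data_of_list [] = Leaf"
| "data_of_list (x # xs) = Node x (data_of_list xs)"

definition rep_nat :: "data \<Rightarrow> nat \<Rightarrow> bool" where
  "rep_nat x n \<longleftrightarrow> x = data_of_nat n"

definition rep_int :: "data \<Rightarrow> int \<Rightarrow> bool" where
  "rep_int x k \<longleftrightarrow> x = Node (data_of_bool (k < 0)) (data_of_nat (nat \<bar>k\<bar>))"

fun rep_enat :: "data \<Rightarrow> enat \<Rightarrow> bool" where
  "rep_enat x (enat n) \<longleftrightarrow> (\<exists>y. rep_nat y n \<and> x = Node Leaf y)"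
| "rep_enat x \<infinity> \<longleftrightarrow> x = Leaf"

fun rep_ext_int :: "data \<Rightarrow> int extended \<Rightarrow> bool" where
  "rep_ext_int x (Fin k) \<longleftrightarrow> (\<exists>y. rep_int y k \<and> x = Node (data_of_bool True) y)"
| "rep_ext_int x Pinf \<longleftrightarrow> x = Leaf"
| "rep_ext_int x Minf \<longleftrightarrow> x = Node Leaf Leaf"

definition rep_prod :: "(data \<Rightarrow> 'a \<Rightarrow> bool) \<Rightarrow> (data \<Rightarrow> 'b \<Rightarrow> bool) \<Rightarrow> data \<Rightarrow> 'a \<times> 'b \<Rightarrow> bool" where
  "rep_prod R S x p \<longleftrightarrow> (\<exists>y z. x = Node y z \<and> R y (fst p) \<and> S z (snd p))"

fun rep_sum :: "(data \<Rightarrow> 'a \<Rightarrow> bool) \<Rightarrow> (data \<Rightarrow> 'b \<Rightarrow> bool) \<Rightarrow> data \<Rightarrow> 'a + 'b \<Rightarrow> bool" where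
  "rep_sum R S x (Inl a) \<longleftrightarrow> (\<exists>y. R y a \<and> x = Node (data_of_bool False) y)"
| "rep_sum R S x (Inr b) \<longleftrightarrow> (\<exists>y. S y b \<and> x = Node (data_of_bool True) y)"

definition rep_set :: "(data \<Rightarrow> 'a \<Rightarrow> bool) \<Rightarrow> data \<Rightarrow> 'a set \<Rightarrow> bool" where
  "rep_set R x A \<longleftrightarrow>
     (\<exists>as xs. distinct as \<and> set as = A \<and> list_all2 R xs as \<and> x = data_of_list xs)"

definition rep_edge :: "data \<Rightarrow> nat set \<Rightarrow> bool" where
  "rep_edge x e \<longleftrightarrow> (\<exists>u v. e = {u, v} \<and> rep_prod rep_nat rep_nat x (u, v))"


section \<open>Polynomial-time reductions between search problems\<close>

text \<open>In an optimization problem the required solutions are the optimal ones.\<close>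

record ('i, 's) search_problem =
  instances :: "'i set"
  rep_instance :: "data \<Rightarrow> 'i \<Rightarrow> bool"
  solves :: "'i \<Rightarrow> 's \<Rightarrow> bool"
  rep_solution :: "data \<Rightarrow> 's \<Rightarrow> bool"

text \<open>The program \<open>f\<close> transforms instances of \<open>P\<close> into instances of \<open>Q\<close>, preserving solvability,
  and \<open>g\<close> transforms every solution of the resulting instance into a solution of the original
  one; both run in polynomial time.\<close>

definition poly_time_reducible ::
  "('i, 's) search_problem \<Rightarrow> ('j, 't) search_problem \<Rightarrow> bool" where
  "poly_time_reducible P Q \<longleftrightarrow>
    (\<exists>f g. \<exists>p :: nat poly.
      \<forall>i \<in> instances P. \<forall>x. rep_instance P x i \<longrightarrow>
        (\<exists>y t. computes_in f x t y \<and> t \<le> poly p (data_size x) \<and>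
          (\<exists>j \<in> instances Q. rep_instance Q y j \<and>
            ((\<exists>r. solves P i r) \<longrightarrow> (\<exists>s. solves Q j s)) \<and>
            (\<forall>s z. solves Q j s \<and> rep_solution Q z s \<longrightarrow>
              (\<exists>w t'. computes_in g (Node x z) t' w \<and> t' \<le> poly p (data_size x + data_size z) \<and>
                (\<exists>r. solves P i r \<and> rep_solution P w r))))))"


section \<open>The densest subgraph problem on planar graphs\<close>

type_synonym ugraph = "nat set \<times> nat set set"

definition simple_graph :: "ugraph \<Rightarrow> bool" where
  "simple_graph G \<longleftrightarrow> finite (fst G) \<and> (\<forall>e \<in> snd G. e \<subseteq> fst G \<and> card e = 2)"

text \<open>A plane drawing: vertices are distinct points, edges are arcs joining their end vertices and
  avoiding all other vertices, and two edges meet only in common end vertices.\<close>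

definition planar :: "ugraph \<Rightarrow> bool" where
  "planar G \<longleftrightarrow>
    (\<exists>(pos :: nat \<Rightarrow> complex) (\<gamma> :: nat set \<Rightarrow> real \<Rightarrow> complex).
      inj_on pos (fst G) \<and>
      (\<forall>e \<in> snd G. arc (\<gamma> e) \<and> {pathstart (\<gamma> e), pathfinish (\<gamma> e)} = pos ` e \<and>
         path_image (\<gamma> e) \<inter> pos ` fst G = pos ` e) \<and>
      (\<forall>e \<in> snd G. \<forall>e' \<in> snd G. e \<noteq> e' \<longrightarrow>
         path_image (\<gamma> e) \<inter> path_image (\<gamma> e') \<subseteq> pos ` (e \<inter> e')))"

definition subgraph_of :: "ugraph \<Rightarrow> ugraph \<Rightarrow> bool" where
  "subgraph_of H G \<longleftrightarrow> simple_graph H \<and> fst H \<subseteq> fst G \<and> snd H \<subseteq> snd G"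

definition densest_subgraph :: "ugraph \<Rightarrow> nat \<Rightarrow> ugraph \<Rightarrow> bool" where
  "densest_subgraph G k H \<longleftrightarrow>
     subgraph_of H G \<and> card (fst H) = k \<and>
     (\<forall>H'. subgraph_of H' G \<and> card (fst H') = k \<longrightarrow> card (snd H') \<le> card (snd H))"

definition rep_ugraph :: "data \<Rightarrow> ugraph \<Rightarrow> bool" where
  "rep_ugraph = rep_prod (rep_set rep_nat) (rep_set rep_edge)"

definition planar_densest_subgraph_problem :: "(ugraph \<times> nat, ugraph) search_problem" where
  "planar_densest_subgraph_problem =
    \<lparr> instances = {(G, k). simple_graph G \<and> planar G \<and> k \<le> card (fst G)},
      rep_instance = rep_prod rep_ugraph rep_nat,
      solves = (\<lambda>(G, k). densest_subgraph G k),
      rep_solution = rep_ugraph \<rparr>"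


section \<open>The network interdiction problem on planar networks\<close>

text \<open>Vertices are natural numbers and arcs are pairs of vertices; an element of \<open>V \<union> E\<close> is
  \<open>Inl v\<close> for a vertex and \<open>Inr e\<close> for an arc.\<close>

type_synonym arc = "nat \<times> nat"

record network =
  verts :: "nat set"
  arcs :: "arc set"
  cap :: "arc \<Rightarrow> nat"
  sources :: "nat set"
  sinks :: "nat set"
  cost :: "nat + arc \<Rightarrow> enat"
  dem :: "nat \<Rightarrow> int extended"

definition elements :: "network \<Rightarrow> (nat + arc) set" where
  "elements N = Inl ` verts N \<union> Inr ` arcs N"

definition interdiction_network :: "network \<Rightarrow> bool" where
  "interdiction_network N \<longleftrightarrow>
     finite (verts N) \<and> arcs N \<subseteq> verts N \<times> verts N \<and>
     sources N \<subseteq> verts N \<and> sinks N \<subseteq> verts N \<and> sources N \<inter> sinks N = {} \<and>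
     (\<forall>s \<in> sources N. dem N s < 0) \<and> (\<forall>t \<in> sinks N. dem N t > 0) \<and>
     (\<forall>v \<in> verts N - (sources N \<union> sinks N). dem N v = 0) \<and>
     (\<forall>p \<in> elements N. cost N p \<ge> 1)"

definition underlying_graph :: "network \<Rightarrow> ugraph" where
  "underlying_graph N = (verts N, {{u, v} | u v. (u, v) \<in> arcs N \<and> u \<noteq> v})"

definition net_outflow :: "network \<Rightarrow> (arc \<Rightarrow> real) \<Rightarrow> nat \<Rightarrow> real" where
  "net_outflow N f v = (\<Sum>e \<in> {e \<in> arcs N. fst e = v}. f e) - (\<Sum>e \<in> {e \<in> arcs N. snd e = v}. f e)"

definition is_flow :: "network \<Rightarrow> (arc \<Rightarrow> real) \<Rightarrow> bool" where
  "is_flow N f \<longleftrightarrow>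
     (\<forall>e \<in> arcs N. 0 \<le> f e \<and> f e \<le> real (cap N e)) \<and>
     (\<forall>v \<in> verts N - (sources N \<union> sinks N). net_outflow N f v = 0) \<and>
     (\<forall>s \<in> sources N. Fin (net_outflow N f s) \<le> map_extended real_of_int (- dem N s)) \<and>
     (\<forall>t \<in> sinks N. Fin (- net_outflow N f t) \<le> map_extended real_of_int (dem N t))"

definition flow_value :: "network \<Rightarrow> (arc \<Rightarrow> real) \<Rightarrow> real" where
  "flow_value N f = (\<Sum>t \<in> sinks N. - net_outflow N f t)"

text \<open>For an interdiction network the values form a non-empty compact set, so that the supremum is
  the maximum.\<close>

definition max_flow_value :: "network \<Rightarrow> real" where
  "max_flow_value N = Sup {flow_value N f | f. is_flow N f}"

definition delete :: "network \<Rightarrow> (nat + arc) set \<Rightarrow> network" where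
  "delete N R = N\<lparr>
     verts := {v \<in> verts N. Inl v \<notin> R},
     arcs := {e \<in> arcs N. Inr e \<notin> R \<and> Inl (fst e) \<notin> R \<and> Inl (snd e) \<notin> R},
     sources := {v \<in> sources N. Inl v \<notin> R},
     sinks := {v \<in> sinks N. Inl v \<notin> R} \<rparr>"

definition interdiction_set :: "network \<Rightarrow> nat \<Rightarrow> (nat + arc) set \<Rightarrow> bool" where
  "interdiction_set N B R \<longleftrightarrow> R \<subseteq> elements N \<and> (\<Sum>r \<in> R. cost N r) \<le> enat B"

definition optimal_interdiction_set :: "network \<Rightarrow> nat \<Rightarrow> (nat + arc) set \<Rightarrow> bool" where
  "optimal_interdiction_set N B R \<longleftrightarrow>
     interdiction_set N B R \<and>
     (\<forall>R'. interdiction_set N B R' \<longrightarrow>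
        max_flow_value (delete N R) \<le> max_flow_value (delete N R'))"

definition numbers_bounded_by :: "nat \<Rightarrow> network \<Rightarrow> nat \<Rightarrow> bool" where
  "numbers_bounded_by M N B \<longleftrightarrow>
     B \<le> M \<and>
     (\<forall>e \<in> arcs N. cap N e \<le> M) \<and>
     (\<forall>p \<in> elements N. \<forall>n. cost N p = enat n \<longrightarrow> n \<le> M) \<and>
     (\<forall>v \<in> verts N. \<forall>k. dem N v = Fin k \<longrightarrow> \<bar>k\<bar> \<le> int M)"

text \<open>The functions \<open>cap\<close>, \<open>cost\<close> and \<open>dem\<close> are listed as tables over the vertices and arcs.\<close>

definition rep_network :: "data \<Rightarrow> network \<Rightarrow> bool" where
  "rep_network x N \<longleftrightarrow>
     rep_prod (rep_set (rep_prod rep_nat (rep_prod rep_enat rep_ext_int)))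
       (rep_prod (rep_set (rep_prod (rep_prod rep_nat rep_nat) (rep_prod rep_nat rep_enat)))
         (rep_prod (rep_set rep_nat) (rep_set rep_nat)))
       x
       ((\<lambda>v. (v, cost N (Inl v), dem N v)) ` verts N,
        (\<lambda>e. (e, cap N e, cost N (Inr e))) ` arcs N,
        sources N, sinks N)"

text \<open>The polynomial \<open>q\<close> bounds all finite input numbers in terms of the number of vertices and
  arcs.\<close>

definition planar_interdiction_problem ::
  "nat poly \<Rightarrow> (network \<times> nat, (nat + arc) set) search_problem" where
  "planar_interdiction_problem q =
    \<lparr> instances = {(N, B). interdiction_network N \<and> planar (underlying_graph N) \<and>
        numbers_bounded_by (poly q (card (verts N) + card (arcs N))) N B},
      rep_instance = rep_prod rep_network rep_nat,
      solves = (\<lambda>(N, B). optimal_interdiction_set N B),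
      rep_solution = rep_set (rep_sum rep_nat (rep_prod rep_nat rep_nat)) \<rparr>"

end

theory Submission
  imports Defs
begin

text \<open>
  Subdivide every edge of the graph.  The subdivision points become sources of supply 1 that cannot
  be interdicted, the original vertices become sinks of unbounded demand that can be removed at cost
  1, and every source has an uninterdictable arc of capacity 1 to each end of its edge.  After
  removing a set \<open>U\<close> of vertices, an edge still contributes one unit of flow unless both of its ends
  lie in \<open>U\<close>, so that the maximum flow is the number of edges minus the number of edges inside \<open>U\<close>.
  With budget \<open>k\<close> an optimal interdiction set is thus a set of at most \<open>k\<close> vertices spanning the
  largest possible number of edges, and any extension of it to exactly \<open>k\<close> vertices induces a densest
  subgraph.
\<close>

section \<open>Unit bipartite networks\<close>

text \<open>Beyond the graph theory, the reduction has to be carried out by WHILE programs without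
  built-in arithmetic, and this fixes the names of the network vertices. Numbers are bit lists with
  the lowest bit first, so \<open>2 * v + 1\<close> arises from \<open>v\<close>, and each power of
  two from the previous one, by a single \<open>Cons\<close>; parity then separates sinks from
  sources, and one \<open>Tl\<close> turns the name of a sink back into its vertex. The source names
  are exponential in value but linear in length, and \<open>numbers_bounded_by\<close> restricts
  capacities, costs, demands and the budget, not names. The recovering program sees the original
  instance and the interdiction set, but not the network, and has to stop at exactly
  \<open>k\<close> vertices. As \<open>k\<close> is given in binary, it needs a binary counter.
  Since reading a variable costs the full size of its value, a time bound for a loop also requires
  size bounds for the lists that the loop builds and rereads.\<close>

lemma max_flow_value_bipartite:
  assumes fin: "finite (sources N)" "finite (sinks N)"
    and arcs: "arcs N \<subseteq> sources N \<times> sinks N"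
    and disj: "sources N \<inter> sinks N = {}"
    and verts: "verts N \<subseteq> sources N \<union> sinks N"
    and cap: "\<And>e. e \<in> arcs N \<Longrightarrow> cap N e = 1"
    and unit_supply: "\<And>s. s \<in> sources N \<Longrightarrow> dem N s = Fin (- 1)"
    and unbounded_demand: "\<And>t. t \<in> sinks N \<Longrightarrow> dem N t = Pinf"
  shows "max_flow_value N = real (card (fst ` arcs N))"
proof -
  have finarcs: "finite (arcs N)"
    using arcs fin by (meson finite_SigmaI finite_subset)
  have out_source: "net_outflow N f s = (\<Sum>e\<in>{e\<in>arcs N. fst e = s}. f e)" if "s \<in> sources N" for f s
  proof -
    have no_in: "{e\<in>arcs N. snd e = s} = {}" using arcs disj that by auto
    show ?thesis unfolding net_outflow_def no_in by simp
  qed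
  have out_sink: "net_outflow N f t = - (\<Sum>e\<in>{e\<in>arcs N. snd e = t}. f e)" if "t \<in> sinks N" for f t
  proof -
    have no_out: "{e\<in>arcs N. fst e = t} = {}" using arcs disj that by auto
    show ?thesis unfolding net_outflow_def no_out by simp
  qed
  \<comment> \<open>Both sides are the sum of \<open>f\<close> over all arcs, grouped by heads and
    by tails. The grouping by tails is the one that the unit supplies bound.\<close>
  have flow_val: "flow_value N f = (\<Sum>s\<in>fst ` arcs N. net_outflow N f s)" for f
  proof -
    have "flow_value N f = (\<Sum>t\<in>sinks N. \<Sum>e\<in>{e\<in>arcs N. snd e = t}. f e)"
      unfolding flow_value_def by (rule sum.cong) (auto simp: out_sink)
    also have "\<dots> = (\<Sum>e\<in>arcs N. f e)"
      using arcs by (intro sum.group finarcs fin) auto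
    also have "\<dots> = (\<Sum>s\<in>fst ` arcs N. \<Sum>e\<in>{e\<in>arcs N. fst e = s}. f e)"
      by (intro sum.group[symmetric] finarcs finite_imageI) auto
    also have "\<dots> = (\<Sum>s\<in>fst ` arcs N. net_outflow N f s)"
      using arcs by (intro sum.cong) (auto simp: out_source)
    finally show ?thesis .
  qed
  have "flow_value N f \<le> real (card (fst ` arcs N))" if "is_flow N f" for f
  proof -
    have "net_outflow N f s \<le> 1" if "s \<in> fst ` arcs N" for s
    proof -
      have "s \<in> sources N" using arcs that by auto
      then show ?thesis using \<open>is_flow N f\<close> unit_supply by (auto simp: is_flow_def)
    qed
    then show ?thesis
      unfolding flow_val using sum_bounded_above[of "fst ` arcs N" "net_outflow N f" 1] by simp
  qed
  moreover have "\<exists>f. is_flow N f \<and> flow_value N f = real (card (fst ` arcs N))"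
  proof -
    \<comment> \<open>\<open>h\<close> selects one outgoing arc for every source that has one. A
      unit along this arc attains the bound, since the capacity is 1 and the sinks accept any
      amount.\<close>
    obtain h where h: "\<And>s. s \<in> fst ` arcs N \<Longrightarrow> (s, h s) \<in> arcs N"
      using bchoice[of "fst ` arcs N" "\<lambda>s t. (s, t) \<in> arcs N"] by force
    define f :: "arc \<Rightarrow> real" where "f e = (if snd e = h (fst e) then 1 else 0)" for e
    have out: "(\<Sum>e\<in>{e\<in>arcs N. fst e = s}. f e) = (if s \<in> fst ` arcs N then 1 else 0)" for s
    proof (cases "s \<in> fst ` arcs N")
      case True
      have "(\<Sum>e\<in>{e\<in>arcs N. fst e = s}. f e) = (\<Sum>e\<in>{(s, h s)}. f e)"
        using h[OF True] finarcs by (intro sum.mono_neutral_right) (auto simp: f_def)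
      then show ?thesis using True by (simp add: f_def)
    next
      case False
      then have "{e\<in>arcs N. fst e = s} = {}" by force
      then show ?thesis using False by (metis sum.empty)
    qed
    have "is_flow N f"
      unfolding is_flow_def
    proof (intro conjI ballI)
      show "0 \<le> f e" "f e \<le> real (cap N e)" if "e \<in> arcs N" for e
        using cap[OF that] by (auto simp: f_def)
      show "net_outflow N f v = 0" if "v \<in> verts N - (sources N \<union> sinks N)" for v
        using that verts by auto
      show "Fin (net_outflow N f s) \<le> map_extended real_of_int (- dem N s)" if "s \<in> sources N" for s
        using that by (simp add: unit_supply out_source out)
      show "Fin (- net_outflow N f t) \<le> map_extended real_of_int (dem N t)" if "t \<in> sinks N" for t
        using that by (simp add: unbounded_demand)
    qed
    moreover have "flow_value N f = (\<Sum>s\<in>fst ` arcs N. 1)"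
      unfolding flow_val
    proof (rule sum.cong[OF refl])
      fix s assume s: "s \<in> fst ` arcs N"
      then have "s \<in> sources N" using arcs by auto
      then show "net_outflow N f s = 1" using s by (simp add: out_source out)
    qed
    ultimately show ?thesis by (intro exI[of _ f]) simp
  qed
  ultimately show ?thesis
    unfolding max_flow_value_def by (intro cSup_eq_maximum) (force, blast)
qed

section \<open>The subdivision network\<close>

text \<open>A vertex \<open>v\<close> of the graph becomes the sink \<open>2 v + 1\<close>, and an edge \<open>e\<close> becomes the source
  \<open>code e\<close>, which is an even number.  Only the sinks can be interdicted.\<close>

definition subdivision_network :: "(nat set \<Rightarrow> nat) \<Rightarrow> ugraph \<Rightarrow> network" where
  "subdivision_network code G =
    \<lparr> verts = code ` snd G \<union> (\<lambda>v. 2 * v + 1) ` fst G,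
      arcs = {(code e, 2 * u + 1) | e u. e \<in> snd G \<and> u \<in> e},
      cap = (\<lambda>_. 1),
      sources = code ` snd G,
      sinks = (\<lambda>v. 2 * v + 1) ` fst G,
      cost = (\<lambda>p. case p of Inl v \<Rightarrow> if odd v then 1 else \<infinity> | Inr _ \<Rightarrow> \<infinity>),
      dem = (\<lambda>v. if odd v then Pinf else Fin (- 1)) \<rparr>"

definition interdict_verts :: "nat set \<Rightarrow> (nat + arc) set" where
  "interdict_verts U = (\<lambda>v. Inl (2 * v + 1)) ` U"

definition induced_edges :: "ugraph \<Rightarrow> nat set \<Rightarrow> nat set set" where
  "induced_edges G U = {e \<in> snd G. e \<subseteq> U}"

lemma simple_graph_finite_edges:
  assumes "simple_graph G"
  shows "finite (snd G)"
proof -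
  have "snd G \<subseteq> Pow (fst G)" "finite (fst G)" using assms by (auto simp: simple_graph_def)
  then show ?thesis using finite_subset by blast
qed

text \<open>The graph-theoretic part works for any injective naming of the edges by even numbers.
  The concrete naming, \<open>edge_code\<close>, depends on the listing of the edges in the input
  and enters only with the program.\<close>

locale edge_coding =
  fixes G :: ugraph and code :: "nat set \<Rightarrow> nat"
  assumes simple: "simple_graph G"
    and inj: "inj_on code (snd G)"
    and even_code: "\<And>e. e \<in> snd G \<Longrightarrow> even (code e)"
begin

abbreviation "N \<equiv> subdivision_network code G"

lemma finite_graph: "finite (fst G)" "finite (snd G)"
  using simple simple_graph_finite_edges by (auto simp: simple_graph_def)

lemma edge_subset: "e \<in> snd G \<Longrightarrow> e \<subseteq> fst G"
  using simple by (auto simp: simple_graph_def)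

lemma interdiction_network_subdivision: "interdiction_network N"
  unfolding interdiction_network_def
proof (intro conjI ballI)
  show "finite (verts N)" using finite_graph by (simp add: subdivision_network_def)
  show "arcs N \<subseteq> verts N \<times> verts N"
    using edge_subset by (auto simp: subdivision_network_def)
  show "sources N \<subseteq> verts N" "sinks N \<subseteq> verts N" by (auto simp: subdivision_network_def)
  have "odd t" if "t \<in> sinks N" for t using that by (auto simp: subdivision_network_def)
  moreover have "even s" if "s \<in> sources N" for s
    using that even_code by (auto simp: subdivision_network_def)
  ultimately show "sources N \<inter> sinks N = {}" by blast
  show "dem N s < 0" if "s \<in> sources N" for s
    using that even_code by (auto simp: subdivision_network_def zero_extended_def)
  show "0 < dem N t" if "t \<in> sinks N" for t
    using that by (auto simp: subdivision_network_def zero_extended_def)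
  show "dem N v = 0" if "v \<in> verts N - (sources N \<union> sinks N)" for v
    using that by (simp add: subdivision_network_def)
  show "1 \<le> cost N p" for p by (simp add: subdivision_network_def split: sum.split)
qed

text \<open>The budget is the only number that grows, and it is at most the number of sinks. The
  constant term of the polynomial covers the unit capacities, costs and demands.\<close>

lemma numbers_bounded_subdivision:
  assumes "k \<le> card (fst G)"
  shows "numbers_bounded_by (poly [:1, 1:] (card (verts N) + card (arcs N))) N k"
proof -
  have "card (fst G) = card ((\<lambda>v. 2 * v + 1) ` fst G)"
    by (rule card_image[symmetric]) (auto simp: inj_on_def)
  also have "\<dots> \<le> card (verts N)"
    using finite_graph by (intro card_mono) (auto simp: subdivision_network_def)
  finally show ?thesis
    using assms
    by (auto simp: numbers_bounded_by_def elements_def subdivision_network_def one_enat_def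
        split: if_splits)
qed

lemma max_flow_value_interdict:
  assumes "U \<subseteq> fst G"
  shows "max_flow_value (delete N (interdict_verts U)) =
    real (card (snd G)) - real (card (induced_edges G U))"
proof -
  let ?D = "delete N (interdict_verts U)"
  \<comment> \<open>Parity keeps the sources out of the removed set. \<open>Suc (2 * v)\<close> is
    the form to which the simplifier brings \<open>2 * v + 1\<close>.\<close>
  have code_neq: "code e \<noteq> Suc (2 * v)" if "e \<in> snd G" for e v
    using even_code[OF that] by presburger
  have arcs: "arcs ?D = {(code e, 2 * u + 1) | e u. e \<in> snd G \<and> u \<in> e \<and> u \<notin> U}"
    using code_neq by (auto simp: delete_def subdivision_network_def interdict_verts_def)
  have sources: "sources ?D = code ` snd G"
    using code_neq by (auto simp: delete_def subdivision_network_def interdict_verts_def)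
  have sinks: "sinks ?D = (\<lambda>v. 2 * v + 1) ` (fst G - U)"
    by (auto simp: delete_def subdivision_network_def interdict_verts_def)
  have "max_flow_value ?D = real (card (fst ` arcs ?D))"
  proof (rule max_flow_value_bipartite)
    show "finite (sources ?D)" "finite (sinks ?D)"
      using finite_graph by (auto simp: sources sinks)
    show "arcs ?D \<subseteq> sources ?D \<times> sinks ?D"
      using edge_subset by (force simp: arcs sources sinks)
    show "sources ?D \<inter> sinks ?D = {}"
      using code_neq by (auto simp: sources sinks)
    show "verts ?D \<subseteq> sources ?D \<union> sinks ?D"
      by (auto simp: delete_def subdivision_network_def)
    show "cap ?D e = 1" for e by (simp add: delete_def subdivision_network_def)
    show "dem ?D s = Fin (- 1)" if "s \<in> sources ?D" for s
      using that even_code by (auto simp: sources delete_def subdivision_network_def)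
    show "dem ?D t = Pinf" if "t \<in> sinks ?D" for t
      using that by (auto simp: sinks delete_def subdivision_network_def)
  qed
  also have "fst ` arcs ?D = code ` (snd G - induced_edges G U)"
    by (force simp: arcs induced_edges_def)
  also have "card \<dots> = card (snd G - induced_edges G U)"
    by (rule card_image) (rule inj_on_subset[OF inj], blast)
  also have "\<dots> = card (snd G) - card (induced_edges G U)"
    using finite_graph by (intro card_Diff_subset) (auto simp: induced_edges_def)
  also have "real \<dots> = real (card (snd G)) - real (card (induced_edges G U))"
    using finite_graph by (intro of_nat_diff card_mono) (auto simp: induced_edges_def)
  finally show ?thesis .
qed

section \<open>Feasible and optimal interdiction sets\<close>

lemma sum_cost_interdict_verts:
  assumes "finite U"
  shows "(\<Sum>r\<in>interdict_verts U. cost N r) = enat (card U)"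
proof -
  have "(\<Sum>r\<in>interdict_verts U. cost N r) = (\<Sum>r\<in>interdict_verts U. 1)"
    by (rule sum.cong) (auto simp: interdict_verts_def subdivision_network_def)
  also have "\<dots> = enat (card (interdict_verts U))" by (simp add: of_nat_eq_enat)
  also have "card (interdict_verts U) = card U"
    unfolding interdict_verts_def by (rule card_image) (auto simp: inj_on_def)
  finally show ?thesis .
qed

lemma interdiction_set_iff:
  "interdiction_set N k R \<longleftrightarrow> (\<exists>U \<subseteq> fst G. card U \<le> k \<and> R = interdict_verts U)"
proof
  assume R: "interdiction_set N k R"
  \<comment> \<open>A sum over an infinite set is 0 by convention, so the budget says something
    about the individual costs only once \<open>R\<close> is known to be finite.\<close>
  have finR: "finite R"
  proof (rule finite_subset)
    show "R \<subseteq> elements N" using R by (simp add: interdiction_set_def)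
    have "arcs N \<subseteq> verts N \<times> verts N" "finite (verts N)"
      using interdiction_network_subdivision by (auto simp: interdiction_network_def)
    then show "finite (elements N)"
      unfolding elements_def by (meson finite_SigmaI finite_UnI finite_imageI finite_subset)
  qed
  have finite_cost: "cost N r \<noteq> \<infinity>" if "r \<in> R" for r
  proof
    assume "cost N r = \<infinity>"
    then have "(\<Sum>r\<in>R. cost N r) = \<infinity>"
      using finR that by (subst sum.remove[of _ r]) auto
    then show False using R by (simp add: interdiction_set_def)
  qed
  have shape: "r \<in> (\<lambda>v. Inl (2 * v + 1)) ` fst G" if "r \<in> R" for r
  proof -
    have "r \<in> elements N" "cost N r \<noteq> \<infinity>"
      using that R finite_cost by (auto simp: interdiction_set_def)
    then show ?thesis
      using even_code by (auto simp: elements_def subdivision_network_def split: if_splits)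
  qed
  define U where "U = {v \<in> fst G. Inl (2 * v + 1) \<in> R}"
  have "R = interdict_verts U" using shape by (auto simp: U_def interdict_verts_def)
  moreover have "U \<subseteq> fst G" by (auto simp: U_def)
  moreover have "card U \<le> k"
    using R sum_cost_interdict_verts[of U] finite_subset[OF \<open>U \<subseteq> fst G\<close>] finite_graph
      \<open>R = interdict_verts U\<close>
    by (simp add: interdiction_set_def)
  ultimately show "\<exists>U \<subseteq> fst G. card U \<le> k \<and> R = interdict_verts U" by blast
next
  assume "\<exists>U \<subseteq> fst G. card U \<le> k \<and> R = interdict_verts U"
  then obtain U where U: "U \<subseteq> fst G" "card U \<le> k" "R = interdict_verts U" by blast
  then have "R \<subseteq> elements N"
    by (auto simp: elements_def interdict_verts_def subdivision_network_def)
  then show "interdiction_set N k R"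
    using U sum_cost_interdict_verts[of U] finite_subset[OF U(1)] finite_graph
    by (simp add: interdiction_set_def)
qed

text \<open>Gives the solvability of the target instance: there are only finitely many feasible
  sets, and the empty set is one of them.\<close>

lemma optimal_interdiction_set_exists: "\<exists>R. optimal_interdiction_set N k R"
proof -
  let ?I = "{R. interdiction_set N k R}"
  have "?I \<subseteq> interdict_verts ` Pow (fst G)" by (auto simp: interdiction_set_iff)
  then have "finite ?I" using finite_graph by (meson finite_Pow_iff finite_imageI finite_subset)
  moreover have "?I \<noteq> {}" by (auto simp: interdiction_set_iff intro!: exI[of _ "{}"])
  ultimately show ?thesis
    using ex_min_if_finite[of "(\<lambda>R. max_flow_value (delete N R)) ` ?I"]
    by (auto simp: optimal_interdiction_set_def not_less)
qed

text \<open>A competitor \<open>H\<close> has at most the edges induced by its \<open>k\<close>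
  vertices. Interdicting these vertices is affordable, so optimality bounds that number by the edges
  inside \<open>U\<close>, and enlarging \<open>U\<close> to \<open>A\<close> loses none.\<close>

lemma densest_subgraph_of_optimal:
  assumes opt: "optimal_interdiction_set N k (interdict_verts U)" and U: "U \<subseteq> fst G"
    and A: "U \<subseteq> A" "A \<subseteq> fst G" "card A = k"
  shows "densest_subgraph G k (A, induced_edges G A)"
  unfolding densest_subgraph_def
proof (intro conjI allI impI)
  show "subgraph_of (A, induced_edges G A) G"
    using A finite_graph finite_subset simple
    by (auto simp: subgraph_of_def simple_graph_def induced_edges_def)
  show "card (fst (A, induced_edges G A)) = k" using A by simp
  fix H assume H: "subgraph_of H G \<and> card (fst H) = k"
  have fin: "finite (induced_edges G X)" for X
    using finite_graph by (simp add: induced_edges_def)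
  have HG: "fst H \<subseteq> fst G" "interdiction_set N k (interdict_verts (fst H))"
    using H by (auto simp: interdiction_set_iff subgraph_of_def)
  have "card (snd H) \<le> card (induced_edges G (fst H))"
    using H fin by (intro card_mono) (auto simp: subgraph_of_def simple_graph_def induced_edges_def)
  also have "\<dots> \<le> card (induced_edges G U)"
  proof -
    have "max_flow_value (delete N (interdict_verts U)) \<le>
        max_flow_value (delete N (interdict_verts (fst H)))"
      using opt HG by (auto simp: optimal_interdiction_set_def)
    then show ?thesis
      unfolding max_flow_value_interdict[OF U] max_flow_value_interdict[OF HG(1)] by simp
  qed
  also have "\<dots> \<le> card (induced_edges G A)"
    using A fin by (intro card_mono) (auto simp: induced_edges_def)
  finally show "card (snd H) \<le> card (snd (A, induced_edges G A))" by simp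
qed


text \<open>Every curve of a given drawing is cut at parameter 1/2. The cut point becomes the
  position of the new source, and the two halves become the drawings of its two arcs.\<close>

lemma planar_subdivision:
  assumes "planar G"
  shows "planar (underlying_graph N)"
proof -
  let ?V = "fst G" and ?E = "snd G"
  obtain pos :: "nat \<Rightarrow> complex" and \<gamma> :: "nat set \<Rightarrow> real \<Rightarrow> complex" where
    inj_pos: "inj_on pos ?V"
    and drawing: "\<And>e. e \<in> ?E \<Longrightarrow> arc (\<gamma> e)"
      "\<And>e. e \<in> ?E \<Longrightarrow> {pathstart (\<gamma> e), pathfinish (\<gamma> e)} = pos ` e"
      "\<And>e. e \<in> ?E \<Longrightarrow> path_image (\<gamma> e) \<inter> pos ` ?V = pos ` e"
    and crossing: "\<And>e e'. \<lbrakk>e \<in> ?E; e' \<in> ?E; e \<noteq> e'\<rbrakk> \<Longrightarrow>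
      path_image (\<gamma> e) \<inter> path_image (\<gamma> e') \<subseteq> pos ` (e \<inter> e')"
    using assms unfolding planar_def by metis
  define mid where "mid e = \<gamma> e (1/2)" for e
  \<comment> \<open>For \<open>u\<close> in \<open>e\<close> this is the half that ends in
    \<open>u\<close>; the orientation of the curve, which the drawing leaves open, is found by
    looking at its start point.\<close>
  define half where "half e u =
    (if \<gamma> e 0 = pos u then subpath 0 (1/2) (\<gamma> e) else subpath (1/2) 1 (\<gamma> e))" for e u
  have ends: "\<exists>a b. e = {a, b} \<and> a \<noteq> b \<and> \<gamma> e 0 = pos a \<and> \<gamma> e 1 = pos b \<and> pos a \<noteq> pos b"
    if "e \<in> ?E" for e
  proof -
    have "card e = 2" "e \<subseteq> ?V" using simple that by (auto simp: simple_graph_def)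
    then obtain a b where ab: "e = {a, b}" "a \<noteq> b" by (auto simp: card_2_iff)
    then have "pos a \<noteq> pos b" using inj_pos \<open>e \<subseteq> ?V\<close> by (auto simp: inj_on_def)
    have "\<gamma> e 0 = pos a \<and> \<gamma> e 1 = pos b \<or> \<gamma> e 0 = pos b \<and> \<gamma> e 1 = pos a"
      using drawing(2)[OF that] ab(1) by (simp add: pathstart_def pathfinish_def doubleton_eq_iff)
    then show ?thesis
    proof
      assume "\<gamma> e 0 = pos a \<and> \<gamma> e 1 = pos b"
      then show ?thesis
        using ab \<open>pos a \<noteq> pos b\<close> by (intro exI[of _ a] exI[of _ b]) simp
    next
      assume "\<gamma> e 0 = pos b \<and> \<gamma> e 1 = pos a"
      then show ?thesis
        using ab \<open>pos a \<noteq> pos b\<close> by (intro exI[of _ b] exI[of _ a]) (simp add: insert_commute)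
    qed
  qed
  have \<gamma>_eq: "s = t" if "e \<in> ?E" "\<gamma> e s = \<gamma> e t" "s \<in> {0..1}" "t \<in> {0..1}" for e s t
    using drawing(1)[OF that(1)] that by (auto simp: arc_def inj_on_def)
  have half_images: "path_image (subpath 0 (1/2) (\<gamma> e)) = \<gamma> e ` {0..1/2}"
      "path_image (subpath (1/2) 1 (\<gamma> e)) = \<gamma> e ` {1/2..1}" for e
    by (auto simp: path_image_subpath)
  have mid_image: "mid e \<in> path_image (\<gamma> e)" for e by (auto simp: mid_def path_image_def)
  have mid_pos: "mid e \<notin> pos ` ?V" if e: "e \<in> ?E" for e
  proof
    assume "mid e \<in> pos ` ?V"
    then have "mid e \<in> pos ` e" using mid_image drawing(3)[OF e] by blast
    then have "\<gamma> e (1/2) = \<gamma> e 0 \<or> \<gamma> e (1/2) = \<gamma> e 1"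
      using drawing(2)[OF e] by (auto simp: mid_def pathstart_def pathfinish_def)
    then show False using \<gamma>_eq[OF e, of "1/2" 0] \<gamma>_eq[OF e, of "1/2" 1] by auto
  qed
  \<comment> \<open>Different curves meet only in vertex positions, and by \<open>mid_pos\<close> a
    cut point is none.\<close>
  have mid_other: "mid e \<notin> path_image (\<gamma> e')" if "e \<in> ?E" "e' \<in> ?E" "e \<noteq> e'" for e e'
    using crossing[OF that] mid_image[of e] mid_pos[OF that(1)] edge_subset[OF that(1)] by blast
  have half_arc: "arc (half e u)" if "e \<in> ?E" "u \<in> e" for e u
    using drawing(1)[OF that(1)] by (auto simp: half_def intro!: arc_subpath_arc)
  have half_ends: "{pathstart (half e u), pathfinish (half e u)} = {mid e, pos u}"
    if "e \<in> ?E" "u \<in> e" for e u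
    using ends[OF that(1)] that(2) by (auto simp: half_def mid_def)
  have half_end_images: "{mid e, pos u} \<subseteq> path_image (half e u)" if "e \<in> ?E" "u \<in> e" for e u
    unfolding half_ends[OF that, symmetric]
    by (simp add: pathstart_in_path_image pathfinish_in_path_image)
  have half_subset: "path_image (half e u) \<subseteq> path_image (\<gamma> e)" if "e \<in> ?E" for e u
    by (simp add: half_def path_image_subpath_subset)
  have half_pos: "path_image (half e u) \<inter> pos ` ?V = {pos u}" if e: "e \<in> ?E" and u: "u \<in> e" for e u
  proof -
    obtain a b where ab: "e = {a, b}" "a \<noteq> b" "\<gamma> e 0 = pos a" "\<gamma> e 1 = pos b" "pos a \<noteq> pos b"
      using ends[OF e] by blast
    have "\<gamma> e 1 \<notin> \<gamma> e ` {0..1/2}" using \<gamma>_eq[OF e, of 1] by force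
    have "\<gamma> e 0 \<notin> \<gamma> e ` {1/2..1}" using \<gamma>_eq[OF e, of 0] by force
    have pos_e: "pos ` e = {pos a, pos b}" by (simp add: ab(1))
    have only: "path_image (half e u) \<inter> pos ` e \<subseteq> {pos u}"
    proof (cases "u = a")
      case True
      then show ?thesis
        using ab(3-5) \<open>\<gamma> e 1 \<notin> \<gamma> e ` {0..1/2}\<close>
        by (simp add: half_def half_images pos_e Int_insert_right)
    next
      case False
      then have "u = b" using ab(1) u by simp
      then show ?thesis
        using ab(3-5) \<open>\<gamma> e 0 \<notin> \<gamma> e ` {1/2..1}\<close>
        by (simp add: half_def half_images pos_e Int_insert_right)
    qed
    have "path_image (half e u) \<inter> pos ` ?V \<subseteq> path_image (\<gamma> e) \<inter> pos ` ?V"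
      using half_subset[OF e] by auto
    then have "path_image (half e u) \<inter> pos ` ?V \<subseteq> {pos u}"
      unfolding drawing(3)[OF e] using only by auto
    moreover have "pos u \<in> path_image (half e u)"
      using half_end_images[OF e u] by simp
    moreover have "u \<in> ?V" using edge_subset[OF e] u by blast
    ultimately show ?thesis by auto
  qed
  have half_mid: "path_image (half e u) \<inter> mid ` ?E = {mid e}" if "e \<in> ?E" "u \<in> e" for e u
  proof -
    have "mid e \<in> path_image (half e u)"
      using half_end_images[OF that] by simp
    moreover have "e' = e" if "e' \<in> ?E" "mid e' \<in> path_image (half e u)" for e'
      using mid_other[OF that(1) \<open>e \<in> ?E\<close>] half_subset[OF \<open>e \<in> ?E\<close>] that(2) by auto
    ultimately show ?thesis using \<open>e \<in> ?E\<close> by auto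
  qed
  have half_half: "path_image (half e u) \<inter> path_image (half e v) \<subseteq> {mid e}"
    if e: "e \<in> ?E" and uv: "u \<in> e" "v \<in> e" "u \<noteq> v" for e u v
  proof -
    obtain a b where ab: "e = {a, b}" "a \<noteq> b" "\<gamma> e 0 = pos a" "\<gamma> e 1 = pos b" "pos a \<noteq> pos b"
      using ends[OF e] by blast
    have "\<gamma> e ` {0..1/2} \<inter> \<gamma> e ` {1/2..1} \<subseteq> {mid e}"
    proof
      fix z assume "z \<in> \<gamma> e ` {0..1/2} \<inter> \<gamma> e ` {1/2..1}"
      then obtain s t where st: "z = \<gamma> e s" "z = \<gamma> e t" "s \<in> {0..1/2}" "t \<in> {1/2..1}" by blast
      then have "s = t" using \<gamma>_eq[OF e, of s t] by auto
      then have "s = 1/2" using st by auto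
      then show "z \<in> {mid e}" using st(1) unfolding mid_def by (metis singletonI)
    qed
    then have "path_image (half e a) \<inter> path_image (half e b) \<subseteq> {mid e}"
      using ab(3-5) by (simp add: half_def half_images)
    moreover have "u = a \<and> v = b \<or> u = b \<and> v = a" using ab(1) uv by blast
    ultimately show ?thesis by (metis Int_commute)
  qed
  define pos' where "pos' w = (if odd w then pos (w div 2) else mid (inv_into ?E code w))" for w
  \<comment> \<open>A drawing assigns curves to unordered pairs, so the edge and the end have to be
    recovered from the set \<open>F\<close>: the even member is the code of the edge, the odd one
    the name of the end.\<close>
  define \<gamma>' where "\<gamma>' F =
    half (inv_into ?E code (SOME w. w \<in> F \<and> even w)) ((SOME w. w \<in> F \<and> odd w) div 2)" for F
  have pos'_odd: "pos' (2 * v + 1) = pos v" for v by (simp add: pos'_def)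
  have pos'_code: "pos' (code e) = mid e" if "e \<in> ?E" for e
    using that even_code inj by (simp add: pos'_def)
  have \<gamma>'_eq: "\<gamma>' {code e, 2 * u + 1} = half e u" if "e \<in> ?E" for e u
  proof -
    have "(SOME w. w \<in> {code e, 2 * u + 1} \<and> even w) = code e"
      using even_code[OF that] by (intro some_equality) auto
    moreover have "(SOME w. w \<in> {code e, 2 * u + 1} \<and> odd w) = 2 * u + 1"
      using even_code[OF that] by (intro some_equality) auto
    ultimately show ?thesis using that inj by (simp add: \<gamma>'_def)
  qed
  have verts': "fst (underlying_graph N) = code ` ?E \<union> (\<lambda>v. 2 * v + 1) ` ?V"
    by (simp add: underlying_graph_def subdivision_network_def)
  have edges': "\<exists>e u. F = {code e, 2 * u + 1} \<and> e \<in> ?E \<and> u \<in> e"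
    if "F \<in> snd (underlying_graph N)" for F
    using that by (auto simp: underlying_graph_def subdivision_network_def)
  have pos'_verts: "pos' ` fst (underlying_graph N) = mid ` ?E \<union> pos ` ?V"
    unfolding verts' image_Un image_image using pos'_odd pos'_code by simp
  show ?thesis
    unfolding planar_def
  proof (intro exI[of _ pos'] exI[of _ \<gamma>'] conjI ballI impI)
    have "inj_on mid ?E" using mid_image mid_other by (metis inj_onI)
    then have "inj_on pos' (code ` ?E)"
      using pos'_code by (auto simp: inj_on_def)
    moreover have "inj_on pos' ((\<lambda>v. 2 * v + 1) ` ?V)"
      using inj_pos pos'_odd by (auto simp: inj_on_def)
    moreover have "pos' ` code ` ?E \<inter> pos' ` (\<lambda>v. 2 * v + 1) ` ?V = {}"
      unfolding image_image using mid_pos pos'_odd pos'_code by auto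
    ultimately show "inj_on pos' (fst (underlying_graph N))"
      unfolding verts' inj_on_Un by blast
  next
    fix F assume "F \<in> snd (underlying_graph N)"
    then obtain e u where F: "F = {code e, 2 * u + 1}" "e \<in> ?E" "u \<in> e" using edges' by blast
    have pos'_F: "pos' ` F = {mid e, pos u}"
      unfolding F(1) using pos'_code[OF F(2)] pos'_odd[of u] by simp
    have \<gamma>'_F: "\<gamma>' F = half e u" using \<gamma>'_eq[OF F(2)] F(1) by simp
    show "arc (\<gamma>' F)" unfolding \<gamma>'_F using half_arc F by blast
    show "{pathstart (\<gamma>' F), pathfinish (\<gamma>' F)} = pos' ` F"
      unfolding \<gamma>'_F pos'_F using half_ends F by blast
    show "path_image (\<gamma>' F) \<inter> pos' ` fst (underlying_graph N) = pos' ` F"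
      unfolding \<gamma>'_F pos'_F pos'_verts Int_Un_distrib half_pos[OF F(2,3)] half_mid[OF F(2,3)]
      by blast
  next
    fix F F' assume "F \<in> snd (underlying_graph N)" "F' \<in> snd (underlying_graph N)" "F \<noteq> F'"
    then obtain e u e' u' where F: "F = {code e, 2 * u + 1}" "e \<in> ?E" "u \<in> e"
      and F': "F' = {code e', 2 * u' + 1}" "e' \<in> ?E" "u' \<in> e'"
      using edges' by metis
    have \<gamma>'_F: "\<gamma>' F = half e u" "\<gamma>' F' = half e' u'"
      using \<gamma>'_eq F(1,2) F'(1,2) by simp_all
    show "path_image (\<gamma>' F) \<inter> path_image (\<gamma>' F') \<subseteq> pos' ` (F \<inter> F')"
    proof (cases "e = e'")
      case True
      then have "u \<noteq> u'" using \<open>F \<noteq> F'\<close> F F' by auto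
      then have "path_image (\<gamma>' F) \<inter> path_image (\<gamma>' F') \<subseteq> {pos' (code e)}"
        unfolding \<gamma>'_F pos'_code[OF F(2)] using half_half F F' True by blast
      then show ?thesis using F F' True by blast
    next
      \<comment> \<open>Halves of different edges can meet only in a vertex position. Each half
        contains just one of these, that of its own end, so the two ends agree.\<close>
      case False
      show ?thesis
      proof
        fix z assume z: "z \<in> path_image (\<gamma>' F) \<inter> path_image (\<gamma>' F')"
        then have "z \<in> pos ` (e \<inter> e')"
          using crossing[OF F(2) F'(2) False] half_subset[OF F(2)] half_subset[OF F'(2)]
          unfolding \<gamma>'_F by blast
        then have "z \<in> pos ` ?V" using edge_subset[OF F(2)] by blast
        then have "z = pos u" "z = pos u'"
          using z half_pos[OF F(2,3)] half_pos[OF F'(2,3)] unfolding \<gamma>'_F by blast+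
        moreover have "u \<in> ?V" "u' \<in> ?V"
          using edge_subset[OF F(2)] edge_subset[OF F'(2)] F(3) F'(3) by blast+
        ultimately have "u = u'" using inj_pos by (auto simp: inj_on_def)
        then have "2 * u + 1 \<in> F \<inter> F'" using F(1) F'(1) by simp
        then show "z \<in> pos' ` (F \<inter> F')" using \<open>z = pos u\<close> pos'_odd by (metis imageI)
      qed
    qed
  qed
qed

end

section \<open>Running time of programs\<close>

text \<open>\<open>a\<close> is time spent before \<open>c\<close> starts; carrying it along avoids subtracting from the bound \<open>T\<close>.\<close>

definition runs :: "cmd \<Rightarrow> store \<Rightarrow> nat \<Rightarrow> nat \<Rightarrow> (store \<Rightarrow> bool) \<Rightarrow> bool" where
  "runs c s a T Q \<longleftrightarrow> (\<exists>t s'. exec c s t s' \<and> a + t \<le> T \<and> Q s')"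

text \<open>A run with offset \<open>a\<close> and bound \<open>T\<close> takes at most
  \<open>T - a\<close> steps. The arithmetic premise says, without subtraction, that this fits
  between \<open>b\<close> and \<open>T'\<close>.\<close>

lemma runs_weaken:
  assumes "runs c s a T Q" "b + T \<le> a + T'" "\<And>s'. Q s' \<Longrightarrow> Q' s'"
  shows "runs c s b T' Q'"
proof -
  obtain t s' where "exec c s t s'" "a + t \<le> T" "Q s'" using assms(1) by (auto simp: runs_def)
  moreover from this have "b + t \<le> T'" using assms(2) by linarith
  ultimately show ?thesis using assms(3) by (auto simp: runs_def)
qed

lemma runs_Assign:
  "a + 1 + expr_time e s \<le> T \<Longrightarrow> Q (s(x := expr_val e s)) \<Longrightarrow> runs (Assign x e) s a T Q"
  unfolding runs_def by (intro exI conjI, rule exec.Assign) auto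

text \<open>\<open>c1\<close> is timed from zero and its whole bound \<open>U\<close> is charged to
  what follows, so that the lemmas about loops and subprograms, which start at offset 0, apply as
  they stand.\<close>

lemma runs_Seq:
  assumes "runs c1 s 0 U P" "\<And>s'. P s' \<Longrightarrow> runs c2 s' (a + 1 + U) T Q"
  shows "runs (Seq c1 c2) s a T Q"
proof -
  obtain t1 s1 where 1: "exec c1 s t1 s1" "t1 \<le> U" "P s1"
    using assms(1) by (auto simp: runs_def)
  obtain t2 s2 where 2: "exec c2 s1 t2 s2" "a + 1 + U + t2 \<le> T" "Q s2"
    using assms(2)[OF 1(3)] by (auto simp: runs_def)
  have "a + (1 + t1 + t2) \<le> T" using 1 2 by linarith
  then show ?thesis unfolding runs_def using exec.Seq[OF 1(1) 2(1)] 2(3) by blast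
qed

lemma runs_Seq_Assign:
  "runs c (s(x := expr_val e s)) (a + 2 + expr_time e s) T Q \<Longrightarrow>
    runs (Seq (Assign x e) c) s a T Q"
  by (rule runs_Seq[where P = "\<lambda>s'. s' = s(x := expr_val e s)" and U = "1 + expr_time e s"])
    (auto intro: runs_Assign)

lemma runs_If:
  assumes "expr_val e s \<noteq> Leaf \<Longrightarrow> runs c1 s (a + 1 + expr_time e s) T Q"
    and "expr_val e s = Leaf \<Longrightarrow> runs c2 s (a + 1 + expr_time e s) T Q"
  shows "runs (If e c1 c2) s a T Q"
proof (cases "expr_val e s = Leaf")
  case True
  then obtain t s' where "exec c2 s t s'" "a + 1 + expr_time e s + t \<le> T" "Q s'"
    using assms(2) by (auto simp: runs_def)
  then show ?thesis
    unfolding runs_def using exec.IfFalse[OF True] by (metis add.assoc)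
next
  case False
  then obtain t s' where "exec c1 s t s'" "a + 1 + expr_time e s + t \<le> T" "Q s'"
    using assms(1) by (auto simp: runs_def)
  then show ?thesis
    unfolding runs_def using exec.IfTrue[OF False] by (metis add.assoc)
qed

lemma runs_While_False:
  "expr_val e s = Leaf \<Longrightarrow> a + 1 + expr_time e s \<le> T \<Longrightarrow> Q s \<Longrightarrow> runs (While e c) s a T Q"
  unfolding runs_def using exec.WhileFalse by (metis add.assoc)

lemma runs_While_True:
  assumes "expr_val e s \<noteq> Leaf" "runs c s 0 U P"
    and "\<And>s'. P s' \<Longrightarrow> runs (While e c) s' (a + 1 + expr_time e s + U) T Q"
  shows "runs (While e c) s a T Q"
proof -
  obtain t1 s1 where 1: "exec c s t1 s1" "t1 \<le> U" "P s1"
    using assms(2) by (auto simp: runs_def)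
  obtain t2 s2 where 2: "exec (While e c) s1 t2 s2"
      "a + 1 + expr_time e s + U + t2 \<le> T" "Q s2"
    using assms(3)[OF 1(3)] by (auto simp: runs_def)
  have "a + (1 + expr_time e s + t1 + t2) \<le> T" using 1 2 by linarith
  then show ?thesis
    unfolding runs_def using exec.WhileTrue[OF assms(1) 1(1) 2(1)] 2(3) by blast
qed

lemma data_size_data_of_list_append:
  "data_size (data_of_list (xs @ ys)) + 1 = data_size (data_of_list xs) + data_size (data_of_list ys)"
  by (induction xs) auto

lemma length_less_data_size: "length xs < data_size (data_of_list xs)"
  by (induction xs) auto

lemma data_size_element_less: "x \<in> set xs \<Longrightarrow> data_size x < data_size (data_of_list xs)"
  by (induction xs) auto

lemma data_size_pos: "1 \<le> data_size x"
  by (cases x) auto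

lemma data_size_data_of_list_le:
  "(\<And>x. x \<in> set xs \<Longrightarrow> data_size x < B) \<Longrightarrow> data_size (data_of_list xs) \<le> 1 + length xs * B"
  by (induction xs) fastforce+

text \<open>The rule for loops that consume a list held in variable \<open>y\<close>. The invariant
  is indexed by the processed prefix. \<open>D\<close> pays for reading \<open>y\<close> in the loop
  test, where a suffix never exceeds the whole list; the final 2 is the last test, on
  \<open>Leaf\<close>.\<close>

lemma runs_While_list:
  assumes init: "I [] s" "s y = data_of_list (map enc xs)"
    and size: "data_size (data_of_list (map enc xs)) \<le> D"
    and step: "\<And>ys x zs s. \<lbrakk>xs = ys @ x # zs; I ys s;
      s y = Node (enc x) (data_of_list (map enc zs))\<rbrakk> \<Longrightarrow>
      runs c s 0 T (\<lambda>s'. I (ys @ [x]) s' \<and> s' y = data_of_list (map enc zs))"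
  shows "runs (While (Var y) c) s 0 (length xs * (T + 1 + D) + 2) (\<lambda>s'. I xs s' \<and> s' y = Leaf)"
proof -
  have "runs (While (Var y) c) s 0 (length zs * (T + 1 + D) + 2) (\<lambda>s'. I xs s' \<and> s' y = Leaf)"
    if "xs = ys @ zs" "I ys s" "s y = data_of_list (map enc zs)" for ys zs s
    using that
  proof (induction zs arbitrary: ys s)
    case Nil
    then show ?case by (intro runs_While_False) auto
  next
    case (Cons x zs)
    have D: "data_size (s y) \<le> D"
      using size data_size_data_of_list_append[of "map enc ys" "map enc (x # zs)"]
        data_size_pos[of "data_of_list (map enc ys)"] Cons.prems
      by simp
    show ?case
    proof (rule runs_While_True)
      show "expr_val (Var y) s \<noteq> Leaf" using Cons.prems by simp
      show "runs c s 0 T (\<lambda>s'. I (ys @ [x]) s' \<and> s' y = data_of_list (map enc zs))"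
        using Cons.prems by (intro step) auto
      fix s' assume s': "I (ys @ [x]) s' \<and> s' y = data_of_list (map enc zs)"
      have "runs (While (Var y) c) s' 0 (length zs * (T + 1 + D) + 2) (\<lambda>s'. I xs s' \<and> s' y = Leaf)"
        using s' Cons.prems by (intro Cons.IH[of "ys @ [x]"]) auto
      then show "runs (While (Var y) c) s' (0 + 1 + expr_time (Var y) s + T)
          (length (x # zs) * (T + 1 + D) + 2) (\<lambda>s'. I xs s' \<and> s' y = Leaf)"
        by (rule runs_weaken) (use D in auto)
    qed
  qed
  from this[of "[]" xs s] init show ?thesis by simp
qed

section \<open>Binary numbers\<close>

lemma data_of_nat_0 [simp]: "data_of_nat 0 = Leaf"
  by (simp add: data_of_nat.simps)

text \<open>With the lowest bit first, doubling prepends one zero bit. For \<open>m = 0\<close> this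
  would create a leading zero.\<close>

lemma data_of_nat_double: "m > 0 \<Longrightarrow> data_of_nat (2 * m) = Node Leaf (data_of_nat m)"
  by (subst data_of_nat.simps) (simp add: data_of_bool_def)

lemma data_of_nat_Suc_double [simp]:
  "data_of_nat (Suc (2 * m)) = Node (Node Leaf Leaf) (data_of_nat m)"
  by (subst data_of_nat.simps) (simp add: data_of_bool_def)

lemma data_of_nat_1: "data_of_nat (Suc 0) = Node (Node Leaf Leaf) Leaf"
  using data_of_nat_Suc_double[of 0] by simp

lemma data_of_nat_power_Suc [simp]:
  "data_of_nat (2 * 2 ^ i) = Node Leaf (data_of_nat (2 ^ i))"
  by (simp add: data_of_nat_double)

lemma data_hd_data_of_nat: "data_hd (data_of_nat n) \<noteq> Leaf \<longleftrightarrow> odd n"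
  by (subst data_of_nat.simps) (auto simp: data_of_bool_def elim: oddE)

lemma data_tl_data_of_nat: "data_tl (data_of_nat n) = data_of_nat (n div 2)"
  by (subst data_of_nat.simps) auto

text \<open>Makes the \<open>Eq\<close> test of the programs decide equality of the represented
  numbers.\<close>

lemma data_of_nat_inject [simp]: "data_of_nat m = data_of_nat n \<longleftrightarrow> m = n"
proof
  show "data_of_nat m = data_of_nat n \<Longrightarrow> m = n"
  proof (induction m arbitrary: n rule: less_induct)
    case (less m)
    have eq: "odd m \<longleftrightarrow> odd n" "data_of_nat (m div 2) = data_of_nat (n div 2)"
      using less.prems data_hd_data_of_nat data_tl_data_of_nat by metis+
    show ?case
    proof (cases "m = 0")
      case True
      then show ?thesis
        using less.prems by (subst (asm) (2) data_of_nat.simps) (auto split: if_splits)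
    next
      case False
      then have "m div 2 = n div 2" by (intro less.IH) (use eq in auto)
      then show ?thesis using eq(1) by presburger
    qed
  qed
qed simp

text \<open>A bound linear in the value instead of its logarithm is enough, because it is applied to
  counters that are themselves bounded by list lengths.\<close>

lemma data_size_data_of_nat: "data_size (data_of_nat n) \<le> 4 * n + 1"
proof (induction n rule: less_induct)
  case (less n)
  show ?case
  proof (cases "n = 0")
    case False
    then have "data_size (data_of_nat (n div 2)) \<le> 4 * (n div 2) + 1" by (intro less.IH) auto
    moreover have "data_size (data_of_nat n) = 1 + (if odd n then 3 else 1) + data_size (data_of_nat (n div 2))"
      using False by (subst data_of_nat.simps) (auto simp: data_of_bool_def)
    ultimately show ?thesis using False by (auto elim!: oddE evenE)
  qed simp
qed

lemma data_size_data_of_nat_power: "data_size (data_of_nat (2 ^ i)) = 2 * i + 5"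
  by (induction i) (auto simp: data_of_nat_1)

section \<open>Incrementing a binary number\<close>

notation Seq (infixr \<open>;;\<close> 60)

abbreviation one_expr :: expr where
  "one_expr \<equiv> expr.Cons Const_Leaf Const_Leaf"

text \<open>The language has no empty command; variable 11 is reserved as the target of a harmless
  assignment.\<close>

definition skip :: cmd where
  "skip = Assign 11 Const_Leaf"

lemma runs_skip: "a + 2 \<le> T \<Longrightarrow> Q (s(11 := Leaf)) \<Longrightarrow> runs skip s a T Q"
  unfolding skip_def by (rule runs_Assign) auto

text \<open>A number \<open>n = (m + 1) 2\<^sup>j - 1\<close> with \<open>m\<close> even has \<open>j\<close> trailing one bits; they are
  turned into zero bits, parked in variable 10, and \<open>m\<close> is incremented by setting its last bit.\<close>

definition strip_ones :: cmd where
  "strip_ones = While (Hd (Var 4))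
    (Assign 10 (expr.Cons Const_Leaf (Var 10)) ;; Assign 4 (Tl (Var 4)))"

definition increment :: cmd where
  "increment = Assign 10 Const_Leaf ;; strip_ones ;; Assign 4 (expr.Cons one_expr (Tl (Var 4))) ;;
    While (Var 10) (Assign 4 (expr.Cons Const_Leaf (Var 4)) ;; Assign 10 (Tl (Var 10)))"

abbreviation zeros :: "nat \<Rightarrow> data" where
  "zeros j \<equiv> data_of_list (replicate j Leaf)"

lemma data_size_zeros: "data_size (zeros j) = 2 * j + 1"
  by (induction j) auto

text \<open>For odd \<open>m\<close>, \<open>m + 1 = 2 * (m div 2 + 1)\<close>, so moving a trailing
  one bit to the parked zeros keeps \<open>(m + 1) * 2 ^ j\<close> invariant and does not increase
  \<open>m + j\<close>. The time allows \<open>12 * K + 20\<close> per iteration and generously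
  counts \<open>m + 1\<close> iterations.\<close>

lemma runs_strip_ones:
  assumes "s 4 = data_of_nat m" "s 10 = zeros j" "m + j \<le> K"
  shows "runs strip_ones s 0 ((m + 1) * (12 * K + 20)) (\<lambda>s'. \<exists>m' j'. even m' \<and>
      s' = s(4 := data_of_nat m', 10 := zeros j') \<and>
      (m + 1) * 2 ^ j = (m' + 1) * 2 ^ j' \<and> m' + j' \<le> K)"
  using assms
proof (induction m arbitrary: s j rule: less_induct)
  case (less m)
  have size: "data_size (s 4) \<le> 4 * K + 1" "data_size (s 10) \<le> 2 * K + 1"
    using less.prems data_size_data_of_nat[of m] by (auto simp: data_size_zeros)
  show ?case
  proof (cases "even m")
    case True
    show ?thesis
      unfolding strip_ones_def
    proof (rule runs_While_False)
      show "expr_val (Hd (Var 4)) s = Leaf" using less.prems True data_hd_data_of_nat by auto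
      show "0 + 1 + expr_time (Hd (Var 4)) s \<le> (m + 1) * (12 * K + 20)" using size by simp
      show "\<exists>m' j'. even m' \<and> s = s(4 := data_of_nat m', 10 := zeros j') \<and>
          (m + 1) * 2 ^ j = (m' + 1) * 2 ^ j' \<and> m' + j' \<le> K"
        using True less.prems by (intro exI[of _ m] exI[of _ j]) (auto simp: fun_eq_iff)
    qed
  next
    case False
    let ?s = "s(10 := zeros (Suc j), 4 := data_of_nat (m div 2))"
    have m: "m div 2 < m" "m div 2 + Suc j \<le> K" "m + 1 = (m div 2 + 1) * 2"
      using False less.prems by (auto elim!: oddE)
    have IH: "runs strip_ones ?s 0 ((m div 2 + 1) * (12 * K + 20)) (\<lambda>s'. \<exists>m' j'. even m' \<and>
        s' = ?s(4 := data_of_nat m', 10 := zeros j') \<and>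
        (m div 2 + 1) * 2 ^ Suc j = (m' + 1) * 2 ^ j' \<and> m' + j' \<le> K)"
      by (rule less.IH) (use m in auto)
    show ?thesis
      unfolding strip_ones_def
    proof (rule runs_While_True)
      show "expr_val (Hd (Var 4)) s \<noteq> Leaf" using less.prems False data_hd_data_of_nat by auto
      show "runs (Assign 10 (expr.Cons Const_Leaf (Var 10)) ;; Assign 4 (Tl (Var 4))) s 0
          (6 * K + 10) (\<lambda>s'. s' = ?s)"
        by (intro runs_Seq_Assign runs_Assign)
          (use size less.prems in \<open>auto simp: data_tl_data_of_nat\<close>)
      fix s' assume "s' = ?s"
      show "runs (While (Hd (Var 4))
          (Assign 10 (expr.Cons Const_Leaf (Var 10)) ;; Assign 4 (Tl (Var 4)))) s'
          (0 + 1 + expr_time (Hd (Var 4)) s + (6 * K + 10)) ((m + 1) * (12 * K + 20))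
          (\<lambda>s'. \<exists>m' j'. even m' \<and> s' = s(4 := data_of_nat m', 10 := zeros j') \<and>
            (m + 1) * 2 ^ j = (m' + 1) * 2 ^ j' \<and> m' + j' \<le> K)"
        unfolding strip_ones_def[symmetric] \<open>s' = ?s\<close>
      proof (rule runs_weaken[OF IH])
        have "(m div 2 + 1) * (12 * K + 20) + (12 * K + 20) \<le> (m + 1) * (12 * K + 20)"
          using mult_le_mono1[of "m div 2 + 2" "m + 1" "12 * K + 20"] m(1) by simp
        then show "0 + 1 + expr_time (Hd (Var 4)) s + (6 * K + 10) + (m div 2 + 1) * (12 * K + 20)
            \<le> 0 + (m + 1) * (12 * K + 20)"
          using size by simp
        fix s'' assume "\<exists>m' j'. even m' \<and> s'' = ?s(4 := data_of_nat m', 10 := zeros j') \<and>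
          (m div 2 + 1) * 2 ^ Suc j = (m' + 1) * 2 ^ j' \<and> m' + j' \<le> K"
        then obtain m' j' where 1: "even m'" "s'' = ?s(4 := data_of_nat m', 10 := zeros j')"
          "(m div 2 + 1) * 2 ^ Suc j = (m' + 1) * 2 ^ j'" "m' + j' \<le> K" by blast
        have "(m + 1) * 2 ^ j = (m' + 1) * 2 ^ j'"
          unfolding m(3) 1(3)[symmetric] by simp
        then show "\<exists>m' j'. even m' \<and> s'' = s(4 := data_of_nat m', 10 := zeros j') \<and>
            (m + 1) * 2 ^ j = (m' + 1) * 2 ^ j' \<and> m' + j' \<le> K"
          using 1 by (intro exI[of _ m'] exI[of _ j']) (auto simp: fun_eq_iff)
      qed
    qed
  qed
qed

lemma runs_increment:
  assumes "s 4 = data_of_nat n" "n \<le> K"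
  shows "runs increment s 0 (50 * (K + 2) * (K + 2)) (\<lambda>s'. s' 4 = data_of_nat (n + 1) \<and>
    (\<forall>v. v \<noteq> 4 \<and> v \<noteq> 10 \<longrightarrow> s' v = s v))"
  unfolding increment_def
proof (intro runs_Seq_Assign, rule runs_Seq)
  let ?s = "s(10 := Leaf)"
  show "runs strip_ones (s(10 := expr_val Const_Leaf s)) 0 ((n + 1) * (12 * K + 20))
    (\<lambda>s'. \<exists>m' j'. even m' \<and> s' = ?s(4 := data_of_nat m', 10 := zeros j') \<and>
      (n + 1) * 2 ^ 0 = (m' + 1) * 2 ^ j' \<and> m' + j' \<le> K)"
    using runs_strip_ones[of ?s n 0 K] assms by simp
  fix s' assume "\<exists>m' j'. even m' \<and> s' = ?s(4 := data_of_nat m', 10 := zeros j') \<and>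
      (n + 1) * 2 ^ 0 = (m' + 1) * 2 ^ j' \<and> m' + j' \<le> K"
  then obtain m j where s': "even m" "s' = ?s(4 := data_of_nat m, 10 := zeros j)"
    "n + 1 = (m + 1) * 2 ^ j" "m + j \<le> K" by auto
  have size: "data_size (data_of_nat m) \<le> 4 * K + 1"
    using data_size_data_of_nat[of m] s'(4) by simp
  \<comment> \<open>As \<open>m\<close> is even, replacing its lowest bit by one yields
    \<open>m + 1\<close>. This includes \<open>m = 0\<close>, because \<open>Tl\<close> maps
    \<open>Leaf\<close> to \<open>Leaf\<close>.\<close>
  define s2 where "s2 = s'(4 := data_of_nat (m + 1))"
  have s2: "s'(4 := expr_val (expr.Cons one_expr (Tl (Var 4))) s') = s2"
    using s'(1,2) by (auto simp: s2_def data_tl_data_of_nat elim!: evenE)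
  \<comment> \<open>The parked zeros are treated as a list of \<open>j\<close> units; each one
    consumed doubles variable 4, which ends at \<open>(m + 1) * 2 ^ j = n + 1\<close>.\<close>
  have loop: "runs (While (Var 10) (Assign 4 (expr.Cons Const_Leaf (Var 4)) ;; Assign 10 (Tl (Var 10))))
      s2 0 (length (replicate j ()) * (6 * K + 20 + 1 + (2 * K + 1)) + 2)
      (\<lambda>s'. (s' 4 = data_of_nat ((m + 1) * 2 ^ length (replicate j ())) \<and>
        (\<forall>v. v \<noteq> 4 \<and> v \<noteq> 10 \<longrightarrow> s' v = s v)) \<and> s' 10 = Leaf)"
  proof (rule runs_While_list[where enc = "\<lambda>_. Leaf"])
    show "s2 4 = data_of_nat ((m + 1) * 2 ^ length []) \<and> (\<forall>v. v \<noteq> 4 \<and> v \<noteq> 10 \<longrightarrow> s2 v = s v)"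
      using s'(2) by (simp add: s2_def)
    show "s2 10 = data_of_list (map (\<lambda>_. Leaf) (replicate j ()))"
      using s'(2) by (simp add: s2_def)
    show "data_size (data_of_list (map (\<lambda>_. Leaf) (replicate j ()))) \<le> 2 * K + 1"
      using s'(4) by (simp add: data_size_zeros)
    fix ys :: "unit list" and x zs t
    assume split: "replicate j () = ys @ x # zs"
      and t: "t 4 = data_of_nat ((m + 1) * 2 ^ length ys) \<and> (\<forall>v. v \<noteq> 4 \<and> v \<noteq> 10 \<longrightarrow> t v = s v)"
      and t10: "t 10 = Node Leaf (data_of_list (map (\<lambda>_. Leaf) zs))"
    have len: "j = length ys + 1 + length zs" using arg_cong[OF split, of length] by simp
    have "(m + 1) * 2 ^ length ys \<le> (m + 1) * 2 ^ j"
      using len by (intro mult_le_mono2 power_increasing) auto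
    then have "(m + 1) * 2 ^ length ys \<le> K + 1" using s'(3) assms(2) by linarith
    then have size4: "data_size (t 4) \<le> 4 * K + 5"
      using data_size_data_of_nat[of "(m + 1) * 2 ^ length ys"] t by simp
    have "map (\<lambda>_. Leaf) zs = replicate (length zs) Leaf"
      by (simp add: map_replicate_const)
    then have size10: "data_size (t 10) \<le> 2 * K + 1"
      unfolding t10 using data_size_zeros[of "length zs"] len s'(4) by simp
    have "data_of_nat (2 * ((m + 1) * 2 ^ length ys)) = Node Leaf (t 4)"
      using t by (subst data_of_nat_double) auto
    then have double: "Node Leaf (t 4) = data_of_nat ((m + 1) * 2 ^ length (ys @ [x]))"
      by (simp add: ac_simps)
    show "runs (Assign 4 (expr.Cons Const_Leaf (Var 4)) ;; Assign 10 (Tl (Var 10))) t 0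
        (6 * K + 20) (\<lambda>s'. (s' 4 = data_of_nat ((m + 1) * 2 ^ length (ys @ [x])) \<and>
          (\<forall>v. v \<noteq> 4 \<and> v \<noteq> 10 \<longrightarrow> s' v = s v)) \<and> s' 10 = data_of_list (map (\<lambda>_. Leaf) zs))"
      unfolding double[symmetric]
      by (intro runs_Seq_Assign runs_Assign) (use size4 size10 t t10 in auto)
  qed
  have time: "0 + 2 + expr_time Const_Leaf s + 1 + (n + 1) * (12 * K + 20) + 2 +
        expr_time (expr.Cons one_expr (Tl (Var 4))) s' +
      (length (replicate j ()) * (6 * K + 20 + 1 + (2 * K + 1)) + 2) \<le> 50 * (K + 2) * (K + 2)"
  proof -
    have "(n + 1) * (12 * K + 20) \<le> (K + 2) * (12 * K + 20)"
      using assms(2) by (intro mult_le_mono1) auto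
    moreover have "j * (8 * K + 22) \<le> (K + 2) * (8 * K + 22)"
      using s'(4) by (intro mult_le_mono1) auto
    moreover have "expr_time (expr.Cons one_expr (Tl (Var 4))) s' \<le> 4 * K + 6"
      using size s'(2) by simp
    ultimately show ?thesis by (simp add: algebra_simps)
  qed
  show "runs (Assign 4 (expr.Cons one_expr (Tl (Var 4))) ;;
      While (Var 10) (Assign 4 (expr.Cons Const_Leaf (Var 4)) ;; Assign 10 (Tl (Var 10)))) s'
      (0 + 2 + expr_time Const_Leaf s + 1 + (n + 1) * (12 * K + 20)) (50 * (K + 2) * (K + 2))
      (\<lambda>s'. s' 4 = data_of_nat (n + 1) \<and> (\<forall>v. v \<noteq> 4 \<and> v \<noteq> 10 \<longrightarrow> s' v = s v))"
  proof (rule runs_Seq_Assign, unfold s2, rule runs_weaken[OF loop])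
    show "0 + 2 + expr_time Const_Leaf s + 1 + (n + 1) * (12 * K + 20) + 2 +
        expr_time (expr.Cons one_expr (Tl (Var 4))) s' +
      (length (replicate j ()) * (6 * K + 20 + 1 + (2 * K + 1)) + 2) \<le> 0 + 50 * (K + 2) * (K + 2)"
      using time by simp
  qed (use s'(3) in auto)
qed

section \<open>Computing the subdivision network\<close>

definition data_of_pair :: "nat \<times> nat \<Rightarrow> data" where
  "data_of_pair p = Node (data_of_nat (fst p)) (data_of_nat (snd p))"

text \<open>A row of the vertex table. The inner \<open>Node Leaf\<close> tags the finite cost 1,
  and the last \<open>Leaf\<close> encodes the demand \<open>Pinf\<close>.\<close>

definition sink_entry :: "nat \<Rightarrow> data" where
  "sink_entry v = Node (data_of_nat (2 * v + 1)) (Node (Node Leaf (data_of_nat 1)) Leaf)"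

text \<open>The first \<open>Leaf\<close> after the name is the infinite cost. The two
  \<open>True\<close> tags mark the demand as finite and as negative, which makes it -1.\<close>

definition source_entry :: "nat \<Rightarrow> data" where
  "source_entry i = Node (data_of_nat (2 ^ (i + 1)))
    (Node Leaf (Node (data_of_bool True) (Node (data_of_bool True) (data_of_nat 1))))"

definition arc_entry :: "nat \<Rightarrow> nat \<Rightarrow> data" where
  "arc_entry i u = Node (Node (data_of_nat (2 ^ (i + 1))) (data_of_nat (2 * u + 1)))
    (Node (data_of_nat 1) Leaf)"

lemmas entry_defs = sink_entry_def source_entry_def arc_entry_def data_of_nat_1 data_of_bool_def

text \<open>The newest edge comes first because the program conses its rows. The cut-off
  \<open>m\<close> makes the expression usable as a loop invariant.\<close>

definition arc_entries :: "(nat \<times> nat) list \<Rightarrow> nat \<Rightarrow> data list" where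
  "arc_entries es m =
    concat (map (\<lambda>i. [arc_entry i (fst (es ! i)), arc_entry i (snd (es ! i))]) (rev [0..<m]))"

text \<open>Variables of \<open>build_network\<close>: 12 and 2 hold the vertices and edges still to be processed,
  3, 6, 7 and 4 collect the vertex table, the arc table, the sources and the sinks, and 5 holds the
  number \<open>2\<^sup>i\<close> of the source created last.\<close>

definition arc_expr :: "expr \<Rightarrow> expr" where
  "arc_expr e = expr.Cons (expr.Cons (Var 5) (expr.Cons one_expr e))
    (expr.Cons (expr.Cons one_expr Const_Leaf) Const_Leaf)"

definition sink_loop :: cmd where
  "sink_loop = While (Var 12)
    (Assign 3 (expr.Cons (expr.Cons (expr.Cons one_expr (Hd (Var 12)))
       (expr.Cons (expr.Cons Const_Leaf (expr.Cons one_expr Const_Leaf)) Const_Leaf)) (Var 3)) ;;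
     Assign 4 (expr.Cons (expr.Cons one_expr (Hd (Var 12))) (Var 4)) ;;
     Assign 12 (Tl (Var 12)))"

text \<open>Prepending a zero bit to variable 5 gives each edge a fresh name. The doubling precedes
  the use, so the odd initial value 1 never becomes a name and edge \<open>i\<close> receives
  \<open>2 ^ (i + 1)\<close>.\<close>

definition source_loop :: cmd where
  "source_loop = While (Var 2)
    (Assign 5 (expr.Cons Const_Leaf (Var 5)) ;;
     Assign 3 (expr.Cons (expr.Cons (Var 5) (expr.Cons Const_Leaf
       (expr.Cons one_expr (expr.Cons one_expr (expr.Cons one_expr Const_Leaf))))) (Var 3)) ;;
     Assign 6 (expr.Cons (arc_expr (Hd (Hd (Var 2))))
       (expr.Cons (arc_expr (Tl (Hd (Var 2)))) (Var 6))) ;;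
     Assign 7 (expr.Cons (Var 5) (Var 7)) ;;
     Assign 2 (Tl (Var 2)))"

text \<open>The final \<open>Tl (Var 0)\<close> hands \<open>k\<close> on unchanged as the
  budget.\<close>

definition build_network :: cmd where
  "build_network = Assign 12 (Hd (Hd (Var 0))) ;; Assign 2 (Tl (Hd (Var 0))) ;; sink_loop ;;
    Assign 5 (expr.Cons one_expr Const_Leaf) ;; source_loop ;;
    Assign 0 (expr.Cons
      (expr.Cons (Var 3) (expr.Cons (Var 6) (expr.Cons (Var 7) (Var 4)))) (Tl (Var 0)))"

definition network_data :: "nat list \<Rightarrow> (nat \<times> nat) list \<Rightarrow> data" where
  "network_data vs es =
    Node (data_of_list (rev (map source_entry [0..<length es]) @ rev (map sink_entry vs)))
      (Node (data_of_list (arc_entries es (length es)))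
        (Node (data_of_list (rev (map (\<lambda>i. data_of_nat (2 ^ (i + 1))) [0..<length es])))
          (data_of_list (rev (map (\<lambda>v. data_of_nat (2 * v + 1)) vs)))))"

text \<open>\<open>K\<close> bounds the growth of either collected list in one iteration. The size
  bounds belong to the invariant because each iteration reads both lists in full.\<close>

lemma runs_sink_loop:
  assumes "s 12 = data_of_list (map data_of_nat vs)" "s 3 = Leaf" "s 4 = Leaf"
    and n: "data_size (data_of_list (map data_of_nat vs)) \<le> n" and K: "n + 40 \<le> K"
  shows "runs sink_loop s 0 (length vs * (10 * (1 + n * K) + 10 * K + 1 + n) + 2) (\<lambda>s'.
    (s' 3 = data_of_list (rev (map sink_entry vs)) \<and>
     s' 4 = data_of_list (rev (map (\<lambda>v. data_of_nat (2 * v + 1)) vs)) \<and>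
     data_size (s' 3) \<le> 1 + length vs * K \<and> data_size (s' 4) \<le> 1 + length vs * K \<and>
     (\<forall>x. x \<noteq> 12 \<and> x \<noteq> 3 \<and> x \<noteq> 4 \<longrightarrow> s' x = s x)) \<and> s' 12 = Leaf)"
  unfolding sink_loop_def
proof (rule runs_While_list[where enc = data_of_nat])
  fix ys x zs and t :: store
  assume split: "vs = ys @ x # zs"
    and inv: "t 3 = data_of_list (rev (map sink_entry ys)) \<and>
      t 4 = data_of_list (rev (map (\<lambda>v. data_of_nat (2 * v + 1)) ys)) \<and>
      data_size (t 3) \<le> 1 + length ys * K \<and> data_size (t 4) \<le> 1 + length ys * K \<and>
      (\<forall>x. x \<noteq> 12 \<and> x \<noteq> 3 \<and> x \<noteq> 4 \<longrightarrow> t x = s x)"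
    and t1: "t 12 = Node (data_of_nat x) (data_of_list (map data_of_nat zs))"
  have size1: "data_size (t 12) \<le> n"
    using n data_size_data_of_list_append[of "map data_of_nat ys" "map data_of_nat (x # zs)"]
      data_size_pos[of "data_of_list (map data_of_nat ys)"]
    unfolding split t1 by simp
  then have sizex: "data_size (data_of_nat x) < n" by (simp add: t1)
  have "length ys < n"
    using length_less_data_size[of "map data_of_nat vs"] n split by simp
  then have "length ys * K \<le> n * K" by (intro mult_le_mono1) simp
  then have size34: "data_size (t 3) \<le> 1 + n * K" "data_size (t 4) \<le> 1 + n * K"
    using inv by linarith+
  show "runs (Assign 3 (expr.Cons (expr.Cons (expr.Cons one_expr (Hd (Var 12)))
       (expr.Cons (expr.Cons Const_Leaf (expr.Cons one_expr Const_Leaf)) Const_Leaf)) (Var 3)) ;;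
     Assign 4 (expr.Cons (expr.Cons one_expr (Hd (Var 12))) (Var 4)) ;;
     Assign 12 (Tl (Var 12))) t 0 (10 * (1 + n * K) + 10 * K) (\<lambda>s'.
    (s' 3 = data_of_list (rev (map sink_entry (ys @ [x]))) \<and>
     s' 4 = data_of_list (rev (map (\<lambda>v. data_of_nat (2 * v + 1)) (ys @ [x]))) \<and>
     data_size (s' 3) \<le> 1 + length (ys @ [x]) * K \<and> data_size (s' 4) \<le> 1 + length (ys @ [x]) * K \<and>
     (\<forall>x. x \<noteq> 12 \<and> x \<noteq> 3 \<and> x \<noteq> 4 \<longrightarrow> s' x = s x)) \<and> s' 12 = data_of_list (map data_of_nat zs))"
  proof (intro runs_Seq_Assign runs_Assign, goal_cases)
    case 1
    show ?case using size1 size34 K by simp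
  next
    case 2
    show ?case using inv t1 sizex K by (elim conjE, simp add: entry_defs)
  qed
qed (use assms in auto)

text \<open>The \<open>6 * n\<close> in \<open>K\<close> comes from the two arc rows added per edge:
  each holds a source name of size about \<open>2 * n\<close> and an end of size below
  \<open>n\<close>. \<open>M\<close> bounds the growing tables, including the sink rows
  \<open>D\<close> that are already present.\<close>

lemma runs_source_loop:
  assumes "s 2 = data_of_list (map data_of_pair es)" "s 3 = data_of_list D"
      "s 5 = data_of_nat 1" "s 6 = Leaf" "s 7 = Leaf"
    and n: "data_size (data_of_list (map data_of_pair es)) \<le> n" and K: "6 * n + 100 \<le> K"
    and M: "data_size (data_of_list D) + n * K \<le> M" "n * K + 1 \<le> M"
  shows "runs source_loop s 0 (length es * (10 * M + 10 * K + 1 + n) + 2) (\<lambda>s'.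
    (s' 3 = data_of_list (rev (map source_entry [0..<length es]) @ D) \<and>
     s' 5 = data_of_nat (2 ^ length es) \<and>
     s' 6 = data_of_list (arc_entries es (length es)) \<and>
     s' 7 = data_of_list (rev (map (\<lambda>i. data_of_nat (2 ^ (i + 1))) [0..<length es])) \<and>
     data_size (s' 3) \<le> data_size (data_of_list D) + length es * K \<and>
     data_size (s' 6) \<le> 1 + length es * K \<and> data_size (s' 7) \<le> 1 + length es * K \<and>
     s' 0 = s 0 \<and> s' 4 = s 4) \<and> s' 2 = Leaf)"
  unfolding source_loop_def
proof (rule runs_While_list[where enc = data_of_pair and I = "\<lambda>ys s'.
    s' 3 = data_of_list (rev (map source_entry [0..<length ys]) @ D) \<and>
     s' 5 = data_of_nat (2 ^ length ys) \<and>
     s' 6 = data_of_list (arc_entries es (length ys)) \<and>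
     s' 7 = data_of_list (rev (map (\<lambda>i. data_of_nat (2 ^ (i + 1))) [0..<length ys])) \<and>
     data_size (s' 3) \<le> data_size (data_of_list D) + length ys * K \<and>
     data_size (s' 6) \<le> 1 + length ys * K \<and> data_size (s' 7) \<le> 1 + length ys * K \<and>
     s' 0 = s 0 \<and> s' 4 = s 4"])
  fix ys x zs and t :: store
  assume split: "es = ys @ x # zs"
    and inv: "t 3 = data_of_list (rev (map source_entry [0..<length ys]) @ D) \<and>
     t 5 = data_of_nat (2 ^ length ys) \<and>
     t 6 = data_of_list (arc_entries es (length ys)) \<and>
     t 7 = data_of_list (rev (map (\<lambda>i. data_of_nat (2 ^ (i + 1))) [0..<length ys])) \<and>
     data_size (t 3) \<le> data_size (data_of_list D) + length ys * K \<and>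
     data_size (t 6) \<le> 1 + length ys * K \<and> data_size (t 7) \<le> 1 + length ys * K \<and>
     t 0 = s 0 \<and> t 4 = s 4"
    and t2: "t 2 = Node (data_of_pair x) (data_of_list (map data_of_pair zs))"
  have size2: "data_size (t 2) \<le> n"
    using n data_size_data_of_list_append[of "map data_of_pair ys" "map data_of_pair (x # zs)"]
      data_size_pos[of "data_of_list (map data_of_pair ys)"]
    unfolding split t2 by simp
  then have sizex: "data_size (data_of_nat (fst x)) < n" "data_size (data_of_nat (snd x)) < n"
    by (simp_all add: t2 data_of_pair_def)
  have len: "length ys < n"
    using length_less_data_size[of "map data_of_pair es"] n split by simp
  then have size5: "data_size (t 5) \<le> 2 * n + 5"
    using inv data_size_data_of_nat_power[of "length ys"] by simp
  have "length ys * K \<le> n * K" using len by (intro mult_le_mono1) simp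
  then have size367: "data_size (t 3) \<le> M" "data_size (t 6) \<le> M" "data_size (t 7) \<le> M"
    using inv M by linarith+
  have es_nth: "es ! length ys = x" by (simp add: split)
  have arcs: "arc_entries es (length (ys @ [x])) =
      arc_entry (length ys) (fst x) # arc_entry (length ys) (snd x) # arc_entries es (length ys)"
    by (simp add: arc_entries_def es_nth)
  show "runs
    (Assign 5 (expr.Cons Const_Leaf (Var 5)) ;;
     Assign 3 (expr.Cons (expr.Cons (Var 5) (expr.Cons Const_Leaf
       (expr.Cons one_expr (expr.Cons one_expr (expr.Cons one_expr Const_Leaf))))) (Var 3)) ;;
     Assign 6 (expr.Cons (arc_expr (Hd (Hd (Var 2))))
       (expr.Cons (arc_expr (Tl (Hd (Var 2)))) (Var 6))) ;;
     Assign 7 (expr.Cons (Var 5) (Var 7)) ;;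
     Assign 2 (Tl (Var 2))) t 0 (10 * M + 10 * K) (\<lambda>s'.
    (s' 3 = data_of_list (rev (map source_entry [0..<length (ys @ [x])]) @ D) \<and>
     s' 5 = data_of_nat (2 ^ length (ys @ [x])) \<and>
     s' 6 = data_of_list (arc_entries es (length (ys @ [x]))) \<and>
     s' 7 = data_of_list (rev (map (\<lambda>i. data_of_nat (2 ^ (i + 1))) [0..<length (ys @ [x])])) \<and>
     data_size (s' 3) \<le> data_size (data_of_list D) + length (ys @ [x]) * K \<and>
     data_size (s' 6) \<le> 1 + length (ys @ [x]) * K \<and> data_size (s' 7) \<le> 1 + length (ys @ [x]) * K \<and>
     s' 0 = s 0 \<and> s' 4 = s 4) \<and> s' 2 = data_of_list (map data_of_pair zs))"
    unfolding arcs
  proof (intro runs_Seq_Assign runs_Assign, goal_cases)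
    case 1
    show ?case using size2 size5 size367 K by (simp add: arc_expr_def)
  next
    case 2
    show ?case using inv t2 sizex size5 K
      by (elim conjE, simp add: entry_defs arc_expr_def data_of_pair_def)
  qed
qed (use assms in \<open>auto simp: arc_entries_def\<close>)

lemma runs_build_network:
  assumes x: "x = Node (Node (data_of_list (map data_of_nat vs)) (data_of_list (map data_of_pair es))) kd"
  defines "n \<equiv> data_size x" and "K \<equiv> 6 * data_size x + 100"
  shows "runs build_network ((\<lambda>_. Leaf)(0 := x)) 0
    (n * (20 * (1 + n * K) + 10 * K + 1 + n) + n * (20 * (1 + n * K) + 10 * K + 1 + n)
      + 20 * (1 + n * K) + 100 * K)
    (\<lambda>s'. s' 0 = Node (network_data vs es) kd)"
proof -
  \<comment> \<open>One \<open>n * K\<close> accounts for the sink rows left by the first loop, the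
    other for the source rows added on top of them.\<close>
  define M where "M = 1 + n * K + n * K"
  have n: "data_size (data_of_list (map data_of_nat vs)) \<le> n"
      "data_size (data_of_list (map data_of_pair es)) \<le> n" "data_size x = n"
    by (simp_all add: n_def x)
  have K: "K = 6 * n + 100" by (simp add: K_def n_def)
  have len: "length vs \<le> n" "length es \<le> n"
    using n length_less_data_size[of "map data_of_nat vs"]
      length_less_data_size[of "map data_of_pair es"] by simp_all
  then have lenK: "length vs * K \<le> n * K" "length es * K \<le> n * K" by simp_all
  define s1 :: store where "s1 = (\<lambda>_. Leaf)(0 := x, 12 := data_of_list (map data_of_nat vs),
    2 := data_of_list (map data_of_pair es))"
  let ?T1 = "length vs * (10 * (1 + n * K) + 10 * K + 1 + n) + 2"
  let ?T2 = "length es * (10 * M + 10 * K + 1 + n) + 2"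
  let ?T = "n * (20 * (1 + n * K) + 10 * K + 1 + n) + n * (20 * (1 + n * K) + 10 * K + 1 + n)
      + 20 * (1 + n * K) + 100 * K"
  have T1: "?T1 \<le> n * (20 * (1 + n * K) + 10 * K + 1 + n) + 2"
    by (intro add_mono order_refl mult_le_mono[OF len(1)]) simp
  have T2: "?T2 \<le> n * (20 * (1 + n * K) + 10 * K + 1 + n) + 2"
    by (intro add_mono order_refl mult_le_mono[OF len(2)]) (simp add: M_def)
  show ?thesis
    unfolding build_network_def
  proof (intro runs_Seq_Assign, rule runs_Seq)
    show "runs sink_loop ((\<lambda>_. Leaf)(0 := x, 12 := expr_val (Hd (Hd (Var 0))) ((\<lambda>_. Leaf)(0 := x)),
        2 := expr_val (Tl (Hd (Var 0))) ((\<lambda>_. Leaf)(0 := x,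
          12 := expr_val (Hd (Hd (Var 0))) ((\<lambda>_. Leaf)(0 := x)))))) 0 ?T1 (\<lambda>s'.
      (s' 3 = data_of_list (rev (map sink_entry vs)) \<and>
       s' 4 = data_of_list (rev (map (\<lambda>v. data_of_nat (2 * v + 1)) vs)) \<and>
       data_size (s' 3) \<le> 1 + length vs * K \<and> data_size (s' 4) \<le> 1 + length vs * K \<and>
       (\<forall>x. x \<noteq> 12 \<and> x \<noteq> 3 \<and> x \<noteq> 4 \<longrightarrow> s' x = s1 x)) \<and> s' 12 = Leaf)"
      using runs_sink_loop[of s1 vs n K] n K by (simp add: s1_def x)
    fix t assume "(t 3 = data_of_list (rev (map sink_entry vs)) \<and>
       t 4 = data_of_list (rev (map (\<lambda>v. data_of_nat (2 * v + 1)) vs)) \<and>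
       data_size (t 3) \<le> 1 + length vs * K \<and> data_size (t 4) \<le> 1 + length vs * K \<and>
       (\<forall>x. x \<noteq> 12 \<and> x \<noteq> 3 \<and> x \<noteq> 4 \<longrightarrow> t x = s1 x)) \<and> t 12 = Leaf"
    then have t: "t 3 = data_of_list (rev (map sink_entry vs))"
        "t 4 = data_of_list (rev (map (\<lambda>v. data_of_nat (2 * v + 1)) vs))"
        "data_size (t 3) \<le> 1 + length vs * K" "data_size (t 4) \<le> 1 + length vs * K"
        "t 0 = x" "t 2 = data_of_list (map data_of_pair es)" "t 6 = Leaf" "t 7 = Leaf"
      by (auto simp: s1_def)
    let ?t = "t(5 := expr_val (expr.Cons one_expr Const_Leaf) t)"
    show "runs (Assign 5 (expr.Cons one_expr Const_Leaf) ;; source_loop ;;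
      Assign 0 (expr.Cons
        (expr.Cons (Var 3) (expr.Cons (Var 6) (expr.Cons (Var 7) (Var 4)))) (Tl (Var 0)))) t
      (0 + 2 + expr_time (Hd (Hd (Var 0))) ((\<lambda>_. Leaf)(0 := x)) + 2 +
        expr_time (Tl (Hd (Var 0))) ((\<lambda>_. Leaf)(0 := x,
          12 := expr_val (Hd (Hd (Var 0))) ((\<lambda>_. Leaf)(0 := x)))) + 1 + ?T1) ?T
      (\<lambda>s'. s' 0 = Node (network_data vs es) kd)"
    proof (intro runs_Seq_Assign, rule runs_Seq)
      show "runs source_loop ?t 0 ?T2 (\<lambda>s'.
        (s' 3 = data_of_list (rev (map source_entry [0..<length es]) @ rev (map sink_entry vs)) \<and>
         s' 5 = data_of_nat (2 ^ length es) \<and>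
         s' 6 = data_of_list (arc_entries es (length es)) \<and>
         s' 7 = data_of_list (rev (map (\<lambda>i. data_of_nat (2 ^ (i + 1))) [0..<length es])) \<and>
         data_size (s' 3) \<le> data_size (data_of_list (rev (map sink_entry vs))) + length es * K \<and>
         data_size (s' 6) \<le> 1 + length es * K \<and> data_size (s' 7) \<le> 1 + length es * K \<and>
         s' 0 = ?t 0 \<and> s' 4 = ?t 4) \<and> s' 2 = Leaf)"
      proof (rule runs_source_loop)
        show "data_size (data_of_list (rev (map sink_entry vs))) + n * K \<le> M"
          unfolding t(1)[symmetric] M_def using t(3) lenK by linarith
      qed (use t n K in \<open>auto simp: data_of_nat_1 M_def\<close>)
      fix r :: store assume r: "(r 3 = data_of_list (rev (map source_entry [0..<length es]) @ rev (map sink_entry vs)) \<and>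
         r 5 = data_of_nat (2 ^ length es) \<and>
         r 6 = data_of_list (arc_entries es (length es)) \<and>
         r 7 = data_of_list (rev (map (\<lambda>i. data_of_nat (2 ^ (i + 1))) [0..<length es])) \<and>
         data_size (r 3) \<le> data_size (data_of_list (rev (map sink_entry vs))) + length es * K \<and>
         data_size (r 6) \<le> 1 + length es * K \<and> data_size (r 7) \<le> 1 + length es * K \<and>
         r 0 = ?t 0 \<and> r 4 = ?t 4) \<and> r 2 = Leaf"
      have size: "data_size (r 3) \<le> 1 + n * K + n * K" "data_size (r 6) \<le> 1 + n * K"
          "data_size (r 7) \<le> 1 + n * K" "data_size (r 4) \<le> 1 + n * K" "data_size (r 0) = n"
      proof -
        have r': "data_size (r 3) \<le> data_size (t 3) + length es * K"
            "data_size (r 6) \<le> 1 + length es * K" "data_size (r 7) \<le> 1 + length es * K"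
            "r 4 = t 4" "r 0 = x"
          using r t(1,5) by auto
        show "data_size (r 3) \<le> 1 + n * K + n * K" "data_size (r 6) \<le> 1 + n * K"
            "data_size (r 7) \<le> 1 + n * K" "data_size (r 4) \<le> 1 + n * K" "data_size (r 0) = n"
          unfolding r'(4,5) using r'(1-3) t(3,4) lenK n(3) by linarith+
      qed
      show "runs (Assign 0 (expr.Cons
          (expr.Cons (Var 3) (expr.Cons (Var 6) (expr.Cons (Var 7) (Var 4)))) (Tl (Var 0)))) r
        (0 + 2 + expr_time (Hd (Hd (Var 0))) ((\<lambda>_. Leaf)(0 := x)) + 2 +
          expr_time (Tl (Hd (Var 0))) ((\<lambda>_. Leaf)(0 := x,
            12 := expr_val (Hd (Hd (Var 0))) ((\<lambda>_. Leaf)(0 := x)))) + 1 + ?T1 + 2 +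
          expr_time (expr.Cons one_expr Const_Leaf) t + 1 + ?T2) ?T
        (\<lambda>s'. s' 0 = Node (network_data vs es) kd)"
      proof (rule runs_Assign)
        have "expr_time (expr.Cons (expr.Cons (Var 3) (expr.Cons (Var 6) (expr.Cons (Var 7) (Var 4))))
            (Tl (Var 0))) r \<le> 5 * (1 + n * K) + n + 5"
          using size by simp
        moreover have "expr_time (Hd (Hd (Var 0))) ((\<lambda>_. Leaf)(0 := x)) = n + 2"
          "expr_time (Tl (Hd (Var 0))) ((\<lambda>_. Leaf)(0 := x,
            12 := expr_val (Hd (Hd (Var 0))) ((\<lambda>_. Leaf)(0 := x)))) = n + 2"
          "expr_time (expr.Cons one_expr Const_Leaf) t = 5"
          using n(3) by simp_all
        ultimately show "0 + 2 + expr_time (Hd (Hd (Var 0))) ((\<lambda>_. Leaf)(0 := x)) + 2 +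
          expr_time (Tl (Hd (Var 0))) ((\<lambda>_. Leaf)(0 := x,
            12 := expr_val (Hd (Hd (Var 0))) ((\<lambda>_. Leaf)(0 := x)))) + 1 + ?T1 + 2 +
          expr_time (expr.Cons one_expr Const_Leaf) t + 1 + ?T2 + 1 +
          expr_time (expr.Cons (expr.Cons (Var 3) (expr.Cons (Var 6) (expr.Cons (Var 7) (Var 4))))
            (Tl (Var 0))) r \<le> ?T"
          using T1 T2 K by linarith
        show "(r(0 := expr_val (expr.Cons (expr.Cons (Var 3) (expr.Cons (Var 6) (expr.Cons (Var 7) (Var 4))))
            (Tl (Var 0))) r)) 0 = Node (network_data vs es) kd"
          using r t by (simp add: network_data_def x)
      qed
    qed
  qed
qed

section \<open>Recovering a densest subgraph\<close>

text \<open>Variables of \<open>extract_subgraph\<close>: 12 holds the interdicted vertices still to be decoded, 2 the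
  candidate vertices, 3 the chosen vertices and 4 their number in binary, 7 the edges still to be
  processed, and 8 the chosen edges; \<open>member_test\<close> returns its answer in 6.\<close>

definition member_test :: "expr \<Rightarrow> cmd" where
  "member_test e = Assign 9 e ;; Assign 6 Const_Leaf ;; Assign 5 (Var 3) ;;
    While (Var 5)
      (If (Eq (Hd (Var 5)) (Var 9)) (Assign 6 one_expr) skip ;; Assign 5 (Tl (Var 5)))"

lemma data_size_suffix_le:
  assumes "data_size (data_of_list (map enc (ys @ zs))) \<le> D"
  shows "data_size (data_of_list (map enc zs)) \<le> D"
  using assms data_size_data_of_list_append[of "map enc ys" "map enc zs"]
    data_size_pos[of "data_of_list (map enc ys)"]
  by simp

lemma runs_member_test:
  assumes s3: "s 3 = data_of_list (map data_of_nat A)" and e: "expr_val e s = data_of_nat v"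
    and D: "expr_time e s \<le> D" "data_size (s 3) \<le> D"
  shows "runs (member_test e) s 0 (D * (5 * D + 50) + 10 * D + 50)
    (\<lambda>s'. s' 6 = data_of_bool (v \<in> set A) \<and>
      (\<forall>x. x \<noteq> 5 \<and> x \<noteq> 6 \<and> x \<noteq> 9 \<and> x \<noteq> 11 \<longrightarrow> s' x = s x))"
  unfolding member_test_def
proof (intro runs_Seq_Assign)
  define s1 where "s1 = s(9 := data_of_nat v, 6 := Leaf, 5 := s 3)"
  have size_v: "data_size (data_of_nat v) \<le> D"
    using data_size_expr_val[of e s] e D(1) by simp
  have len: "length A \<le> D"
    using length_less_data_size[of "map data_of_nat A"] D(2) s3 by simp
  have loop: "runs (While (Var 5)
      (If (Eq (Hd (Var 5)) (Var 9)) (Assign 6 one_expr) skip ;; Assign 5 (Tl (Var 5)))) s1 0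
    (length A * (3 * D + 20 + 1 + D) + 2)
    (\<lambda>s'. (s' 6 = data_of_bool (v \<in> set A) \<and> s' 9 = data_of_nat v \<and>
      (\<forall>x. x \<noteq> 5 \<and> x \<noteq> 6 \<and> x \<noteq> 9 \<and> x \<noteq> 11 \<longrightarrow> s' x = s x)) \<and> s' 5 = Leaf)"
  proof (rule runs_While_list[where enc = data_of_nat])
    fix ys x zs and t :: store
    assume split: "A = ys @ x # zs"
      and t: "t 6 = data_of_bool (v \<in> set ys) \<and> t 9 = data_of_nat v \<and>
        (\<forall>x. x \<noteq> 5 \<and> x \<noteq> 6 \<and> x \<noteq> 9 \<and> x \<noteq> 11 \<longrightarrow> t x = s x)"
      and t5: "t 5 = Node (data_of_nat x) (data_of_list (map data_of_nat zs))"
    have size5: "data_size (t 5) \<le> D"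
      using data_size_suffix_le[of data_of_nat ys "x # zs" D] D(2) s3 split t5 by simp
    show "runs (If (Eq (Hd (Var 5)) (Var 9)) (Assign 6 one_expr) skip ;; Assign 5 (Tl (Var 5))) t 0
      (3 * D + 20) (\<lambda>s'. (s' 6 = data_of_bool (v \<in> set (ys @ [x])) \<and> s' 9 = data_of_nat v \<and>
        (\<forall>x. x \<noteq> 5 \<and> x \<noteq> 6 \<and> x \<noteq> 9 \<and> x \<noteq> 11 \<longrightarrow> s' x = s x)) \<and>
        s' 5 = data_of_list (map data_of_nat zs))"
    proof (rule runs_Seq[where U = "2 * D + 10"])
      show "runs (If (Eq (Hd (Var 5)) (Var 9)) (Assign 6 one_expr) skip) t 0 (2 * D + 10)
        (\<lambda>s'. s' 6 = data_of_bool (v \<in> set (ys @ [x])) \<and> s' 9 = data_of_nat v \<and> s' 5 = t 5 \<and>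
          (\<forall>x. x \<noteq> 5 \<and> x \<noteq> 6 \<and> x \<noteq> 9 \<and> x \<noteq> 11 \<longrightarrow> s' x = s x))"
        by (intro runs_If runs_Assign runs_skip)
          (use size5 size_v t t5 in \<open>auto simp: data_of_bool_def split: if_splits\<close>)
    next
      fix r :: store assume "r 6 = data_of_bool (v \<in> set (ys @ [x])) \<and> r 9 = data_of_nat v \<and> r 5 = t 5 \<and>
          (\<forall>x. x \<noteq> 5 \<and> x \<noteq> 6 \<and> x \<noteq> 9 \<and> x \<noteq> 11 \<longrightarrow> r x = s x)"
      then show "runs (Assign 5 (Tl (Var 5))) r (0 + 1 + (2 * D + 10)) (3 * D + 20)
        (\<lambda>s'. (s' 6 = data_of_bool (v \<in> set (ys @ [x])) \<and> s' 9 = data_of_nat v \<and>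
          (\<forall>x. x \<noteq> 5 \<and> x \<noteq> 6 \<and> x \<noteq> 9 \<and> x \<noteq> 11 \<longrightarrow> s' x = s x)) \<and>
          s' 5 = data_of_list (map data_of_nat zs))"
        by (intro runs_Assign) (use size5 t5 in auto)
    qed
  qed (use D(2) s3 in \<open>auto simp: s1_def data_of_bool_def\<close>)
  have "length A * (3 * D + 20 + 1 + D) \<le> D * (5 * D + 50)"
    by (rule mult_le_mono[OF len]) simp
  then have time: "0 + 2 + expr_time e s + 2 + 1 + 2 + data_size (s 3) +
      (length A * (3 * D + 20 + 1 + D) + 2) \<le> D * (5 * D + 50) + 10 * D + 50"
    using D by linarith
  have store: "s(9 := expr_val e s, 6 := expr_val Const_Leaf (s(9 := expr_val e s)),
      5 := expr_val (Var 3) (s(9 := expr_val e s, 6 := expr_val Const_Leaf (s(9 := expr_val e s)))))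
      = s1"
    by (simp add: s1_def e)
  show "runs (While (Var 5)
      (If (Eq (Hd (Var 5)) (Var 9)) (Assign 6 one_expr) skip ;; Assign 5 (Tl (Var 5))))
    (s(9 := expr_val e s, 6 := expr_val Const_Leaf (s(9 := expr_val e s)),
      5 := expr_val (Var 3) (s(9 := expr_val e s, 6 := expr_val Const_Leaf (s(9 := expr_val e s))))))
    (0 + 2 + expr_time e s + 2 + expr_time Const_Leaf (s(9 := expr_val e s)) + 2 +
      expr_time (Var 3) (s(9 := expr_val e s, 6 := expr_val Const_Leaf (s(9 := expr_val e s)))))
    (D * (5 * D + 50) + 10 * D + 50)
    (\<lambda>s'. s' 6 = data_of_bool (v \<in> set A) \<and>
      (\<forall>x. x \<noteq> 5 \<and> x \<noteq> 6 \<and> x \<noteq> 9 \<and> x \<noteq> 11 \<longrightarrow> s' x = s x))"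
    unfolding store by (rule runs_weaken[OF loop]) (use time in auto)
qed

section \<open>Greedy completion to exactly \<open>k\<close> vertices\<close>

definition pick :: "nat \<Rightarrow> nat list \<Rightarrow> nat \<Rightarrow> nat list" where
  "pick k A v = (if v \<in> set A \<or> length A = k then A else v # A)"

lemma set_foldl_pick: "set (foldl (pick k) A L) \<subseteq> set A \<union> set L"
  by (induction L arbitrary: A) (fastforce simp: pick_def split: if_splits)+

lemma foldl_pick_superset: "set A \<subseteq> set (foldl (pick k) A L)"
  by (induction L arbitrary: A) (fastforce simp: pick_def split: if_splits)+

lemma distinct_foldl_pick: "distinct A \<Longrightarrow> distinct (foldl (pick k) A L)"
  by (induction L arbitrary: A) (auto simp: pick_def)

lemma length_foldl_pick: "length A \<le> k \<Longrightarrow> length (foldl (pick k) A L) \<le> k"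
  by (induction L arbitrary: A) (auto simp: pick_def)

lemma length_foldl_pick_le: "length (foldl (pick k) A L) \<le> length A + length L"
proof (induction L arbitrary: A)
  case (Cons v L)
  show ?case using Cons[of "pick k A v"] by (auto simp: pick_def split: if_splits)
qed simp

text \<open>If the result stays below \<open>k\<close>, the limit was never reached, so no element
  was refused for lack of room.\<close>

lemma foldl_pick_exhausts:
  assumes "length A \<le> k" "distinct A" "length (foldl (pick k) A L) < k"
  shows "set L \<subseteq> set (foldl (pick k) A L)"
  using assms
proof (induction L arbitrary: A)
  case (Cons v L)
  have "length A < k"
  proof (rule ccontr)
    assume "\<not> length A < k"
    then have "length A = k" using Cons.prems by simp
    then have "foldl (pick k) A L' = A" for L' by (induction L') (auto simp: pick_def)
    then show False using Cons.prems \<open>length A = k\<close> by (metis less_irrefl)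
  qed
  then have "v \<in> set (pick k A v)" "length (pick k A v) \<le> k" "distinct (pick k A v)"
    using Cons.prems by (auto simp: pick_def)
  then show ?case
    using Cons.IH[of "pick k A v"] Cons.prems foldl_pick_superset[of "pick k A v" k L] by auto
qed simp

text \<open>Scanning \<open>W\<close> before \<open>vs\<close> gives it priority: its at most
  \<open>k\<close> elements all fit, and \<open>vs\<close> has enough elements to fill the remaining
  places.\<close>

lemma foldl_pick_extends:
  assumes "distinct W" "length W \<le> k" "set W \<subseteq> set vs" "k \<le> card (set vs)"
  defines "A \<equiv> foldl (pick k) [] (W @ vs)"
  shows "set W \<subseteq> set A" "set A \<subseteq> set vs" "card (set A) = k" "distinct A"
proof -
  let ?B = "foldl (pick k) [] W"
  have B: "distinct ?B" "length ?B \<le> k" "set ?B \<subseteq> set W"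
    using distinct_foldl_pick[of "[]"] length_foldl_pick[of "[]"] set_foldl_pick[of k "[]"] by auto
  have "set W \<subseteq> set ?B"
  proof (cases "length ?B < k")
    case True
    then show ?thesis using foldl_pick_exhausts[of "[]" k W] by simp
  next
    case False
    then have "card (set W) \<le> card (set ?B)"
      using B assms(1,2) by (simp add: distinct_card)
    then show ?thesis using B(3) by (metis List.finite_set card_seteq order_refl)
  qed
  then show "set W \<subseteq> set A"
    unfolding A_def foldl_append using foldl_pick_superset[of ?B k vs] by blast
  show A: "set A \<subseteq> set vs" "distinct A"
    unfolding A_def using set_foldl_pick[of k "[]" "W @ vs"] assms(3)
      distinct_foldl_pick[of "[]" k "W @ vs"] by auto
  have "length A \<le> k" unfolding A_def by (rule length_foldl_pick) simp
  moreover have "\<not> length A < k"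
  proof
    assume "length A < k"
    then have "set vs \<subseteq> set A"
      unfolding A_def foldl_append using foldl_pick_exhausts[OF B(2,1), of vs] by simp
    then have "card (set vs) \<le> length A" by (meson List.finite_set card_length card_mono order_trans)
    then show False using \<open>length A < k\<close> assms(4) by simp
  qed
  ultimately show "card (set A) = k" using A(2) by (simp add: distinct_card)
qed

text \<open>Implements \<open>pick\<close>. The number of chosen vertices is kept as a canonical
  binary numeral, so that reaching \<open>k\<close> is a plain \<open>Eq\<close> test against the
  input; this is the purpose of \<open>increment\<close>.\<close>

definition pick_step :: cmd where
  "pick_step = member_test (Hd (Var 2)) ;;
    If (Var 6) skip
      (If (Eq (Var 4) (Tl (Hd (Var 0)))) skip
        (Assign 3 (expr.Cons (Hd (Var 2)) (Var 3)) ;; increment)) ;;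
    Assign 2 (Tl (Var 2))"

definition pick_loop :: cmd where
  "pick_loop = While (Var 2) pick_step"

text \<open>The \<open>D + 1\<close> pays for evaluating \<open>Hd (Var 2)\<close>, one unit more
  than the size of the variable. The doubly nested \<open>Hd\<close> in \<open>edge_step\<close>
  raises it once more.\<close>

abbreviation member_time :: "nat \<Rightarrow> nat" where
  "member_time D \<equiv> (D + 1) * (5 * (D + 1) + 50) + 10 * (D + 1) + 50"

abbreviation pick_time :: "nat \<Rightarrow> nat" where
  "pick_time D \<equiv> member_time D + 50 * (D + 2) * (D + 2) + 20 * D + 50"

lemma runs_pick_step:
  assumes t: "t 2 = Node (data_of_nat v) rest" "t 3 = data_of_list (map data_of_nat A)"
      "t 4 = data_of_nat (length A)" "data_tl (data_hd (t 0)) = data_of_nat k"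
    and D: "data_size (t 0) \<le> D" "data_size (t 2) \<le> D" "data_size (t 3) \<le> D"
      "length A \<le> D" "data_size (t 4) \<le> 4 * D + 1"
  shows "runs pick_step t 0 (pick_time D) (\<lambda>s'.
    s' 3 = data_of_list (map data_of_nat (pick k A v)) \<and>
    s' 4 = data_of_nat (length (pick k A v)) \<and> s' 2 = rest \<and> s' 0 = t 0 \<and>
    s' 7 = t 7 \<and> s' 8 = t 8)"
  unfolding pick_step_def
proof (rule runs_Seq[OF runs_member_test[of t A "Hd (Var 2)" v "D + 1"]], goal_cases)
  case (5 r)
  then have r: "r 6 = data_of_bool (v \<in> set A)" "r 0 = t 0" "r 2 = t 2" "r 3 = t 3" "r 4 = t 4"
      "r 7 = t 7" "r 8 = t 8"
    by auto
  have size6: "data_size (r 6) \<le> 3" by (simp add: r data_of_bool_def)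
  show ?case
  proof (rule runs_Seq[where P = "\<lambda>s'.
    s' 3 = data_of_list (map data_of_nat (pick k A v)) \<and>
    s' 4 = data_of_nat (length (pick k A v)) \<and> s' 2 = t 2 \<and> s' 0 = t 0 \<and>
    s' 7 = t 7 \<and> s' 8 = t 8"
    and U = "50 * (D + 2) * (D + 2) + 9 * D + 30"], goal_cases)
    case 1
    show ?case
    proof (intro runs_If, goal_cases)
      case 1
      then show ?case using r t size6
        by (intro runs_skip) (auto simp: pick_def data_of_bool_def split: if_splits)
    next
      case 2
      then show ?case using r t D size6
        by (intro runs_skip) (auto simp: pick_def data_of_bool_def split: if_splits)
    next
      case 3
      then have new: "v \<notin> set A" "length A \<noteq> k"
        using r t by (auto simp: data_of_bool_def split: if_splits)
      let ?r = "r(3 := expr_val (expr.Cons (Hd (Var 2)) (Var 3)) r)"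
      have "runs increment ?r 0 (50 * (D + 2) * (D + 2)) (\<lambda>s'.
          s' 4 = data_of_nat (length A + 1) \<and> (\<forall>v. v \<noteq> 4 \<and> v \<noteq> 10 \<longrightarrow> s' v = ?r v))"
        by (rule runs_increment) (use r t D in auto)
      then show ?case
        by (intro runs_Seq_Assign, elim runs_weaken) (use new r t D size6 in \<open>auto simp: pick_def\<close>)
    qed
  next
    case (2 q)
    then show ?case using t D by (intro runs_Assign) auto
  qed
qed (use t D in auto)

text \<open>The bound \<open>1 + n * n\<close> on \<open>D\<close> covers the chosen list: at most
  \<open>n\<close> entries, each of size below \<open>n\<close>. Every membership test reads this
  list anew.\<close>

lemma runs_pick_loop:
  assumes s: "s 2 = data_of_list (map data_of_nat L)" "s 3 = Leaf" "s 4 = Leaf"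
      "data_tl (data_hd (s 0)) = data_of_nat k"
    and L: "\<And>v. v \<in> set L \<Longrightarrow> data_size (data_of_nat v) < n" "length L \<le> n"
    and D: "data_size (s 0) \<le> D" "1 + n * n \<le> D" "n \<le> D"
  shows "runs pick_loop s 0 (length L * (pick_time D + 1 + D) + 2) (\<lambda>s'.
    (s' 3 = data_of_list (map data_of_nat (foldl (pick k) [] L)) \<and>
     s' 4 = data_of_nat (length (foldl (pick k) [] L)) \<and> s' 0 = s 0 \<and>
     s' 7 = s 7 \<and> s' 8 = s 8) \<and> s' 2 = Leaf)"
  unfolding pick_loop_def
proof (rule runs_While_list[where enc = data_of_nat])
  have short: "data_size (data_of_list (map data_of_nat B)) \<le> D"
    if "set B \<subseteq> set L" "length B \<le> n" for B
  proof -
    have "data_size (data_of_list (map data_of_nat B)) \<le> 1 + length (map data_of_nat B) * n"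
      using that L(1) by (intro data_size_data_of_list_le) auto
    also have "\<dots> \<le> 1 + n * n" using that(2) by (simp add: mult_le_mono1)
    finally show ?thesis using D(2) by simp
  qed
  show "data_size (data_of_list (map data_of_nat L)) \<le> D" using short L(2) by simp
  fix ys x zs and t :: store
  let ?A = "foldl (pick k) [] ys"
  assume split: "L = ys @ x # zs"
    and t: "t 3 = data_of_list (map data_of_nat ?A) \<and> t 4 = data_of_nat (length ?A) \<and> t 0 = s 0 \<and>
      t 7 = s 7 \<and> t 8 = s 8"
    and t2: "t 2 = Node (data_of_nat x) (data_of_list (map data_of_nat zs))"
  have A: "set ?A \<subseteq> set L" "length ?A \<le> n"
    using set_foldl_pick[of k "[]" ys] length_foldl_pick_le[of k "[]" ys] L(2) split by auto
  have "t 2 = data_of_list (map data_of_nat (x # zs))" using t2 by simp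
  then have size2: "data_size (t 2) \<le> D" using short[of "x # zs"] L(2) split by auto
  have "runs pick_step t 0 (pick_time D) (\<lambda>s'.
    s' 3 = data_of_list (map data_of_nat (pick k ?A x)) \<and>
    s' 4 = data_of_nat (length (pick k ?A x)) \<and> s' 2 = data_of_list (map data_of_nat zs) \<and>
    s' 0 = t 0 \<and> s' 7 = t 7 \<and> s' 8 = t 8)"
  proof (rule runs_pick_step)
    show "data_size (t 4) \<le> 4 * D + 1"
      using data_size_data_of_nat[of "length ?A"] A(2) D(3) t by simp
  qed (use t t2 size2 s D A short[OF A] in auto)
  then show "runs pick_step t 0 (pick_time D) (\<lambda>s'.
    (s' 3 = data_of_list (map data_of_nat (foldl (pick k) [] (ys @ [x]))) \<and>
     s' 4 = data_of_nat (length (foldl (pick k) [] (ys @ [x]))) \<and> s' 0 = s 0 \<and>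
     s' 7 = s 7 \<and> s' 8 = s 8) \<and> s' 2 = data_of_list (map data_of_nat zs))"
    by (rule runs_weaken) (use t in auto)
qed (use s in auto)

section \<open>Selecting the edges induced by the chosen vertices\<close>

definition edge_step :: cmd where
  "edge_step = member_test (Hd (Hd (Var 7))) ;;
    If (Var 6)
      (member_test (Tl (Hd (Var 7))) ;;
       If (Var 6) (Assign 8 (expr.Cons (Hd (Var 7)) (Var 8))) skip)
      skip ;;
    Assign 7 (Tl (Var 7))"

definition edge_loop :: cmd where
  "edge_loop = While (Var 7) edge_step"

abbreviation edge_time :: "nat \<Rightarrow> nat" where
  "edge_time D \<equiv> member_time (D + 1) + member_time (D + 1) + 10 * D + 50"

definition both_in :: "nat list \<Rightarrow> nat \<times> nat \<Rightarrow> bool" where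
  "both_in A p \<longleftrightarrow> fst p \<in> set A \<and> snd p \<in> set A"

lemma runs_edge_step:
  assumes t: "t 7 = Node (data_of_pair p) rest" "t 3 = data_of_list (map data_of_nat A)"
      "t 8 = data_of_list F"
    and D: "data_size (t 7) \<le> D" "data_size (t 3) \<le> D" "data_size (t 8) \<le> D"
  shows "runs edge_step t 0 (edge_time D) (\<lambda>s'.
    s' 8 = data_of_list ((if both_in A p then [data_of_pair p] else []) @ F) \<and>
    s' 3 = t 3 \<and> s' 7 = rest)"
  unfolding edge_step_def
proof (rule runs_Seq[OF runs_member_test[of t A "Hd (Hd (Var 7))" "fst p" "D + 2"]], goal_cases)
  case (5 r)
  then have r: "r 6 = data_of_bool (fst p \<in> set A)" "r 3 = t 3" "r 7 = t 7" "r 8 = t 8" by auto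
  have size6: "data_size (r 6) \<le> 3" by (simp add: r data_of_bool_def)
  show ?case
  proof (rule runs_Seq[where P = "\<lambda>s'.
      s' 8 = data_of_list ((if both_in A p then [data_of_pair p] else []) @ F) \<and>
      s' 3 = t 3 \<and> s' 7 = t 7"
      and U = "member_time (D + 1) + 3 * D + 20"], goal_cases)
    case 1
    show ?case
    proof (rule runs_If, goal_cases)
      case 1
      then have fst: "fst p \<in> set A" using r by (auto simp: data_of_bool_def split: if_splits)
      show ?case
      proof (rule runs_Seq[OF runs_member_test[of r A "Tl (Hd (Var 7))" "snd p" "D + 2"]], goal_cases)
        case (5 q)
        then have q: "q 6 = data_of_bool (snd p \<in> set A)" "q 3 = t 3" "q 7 = t 7" "q 8 = t 8"
          using r by auto
        have size6': "data_size (q 6) \<le> 3" by (simp add: q data_of_bool_def)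
        show ?case
          by (intro runs_If runs_Assign runs_skip)
            (use q t D fst size6 size6' in \<open>auto simp: both_in_def data_of_bool_def split: if_splits\<close>)
      qed (use r t D in \<open>auto simp: data_of_pair_def\<close>)
    next
      case 2
      then have "fst p \<notin> set A" using r by (auto simp: data_of_bool_def split: if_splits)
      then show ?case
        by (intro runs_skip) (use r t size6 in \<open>auto simp: both_in_def\<close>)
    qed
  next
    case (2 q)
    then show ?case by (intro runs_Assign) (use t D in auto)
  qed
qed (use t D in \<open>auto simp: data_of_pair_def\<close>)

lemma runs_edge_loop:
  assumes s: "s 7 = data_of_list (map data_of_pair es)" "s 8 = Leaf"
      "s 3 = data_of_list (map data_of_nat A)"
    and D: "data_size (s 7) \<le> D" "data_size (s 3) \<le> D"
  shows "runs edge_loop s 0 (length es * (edge_time D + 1 + D) + 2) (\<lambda>s'.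
    (s' 8 = data_of_list (rev (map data_of_pair (filter (both_in A) es))) \<and>
     data_size (s' 8) \<le> D \<and> s' 3 = s 3) \<and> s' 7 = Leaf)"
proof -
  \<comment> \<open>The collected edges form a sublist of the input list, so no separate growth
    bound is needed.\<close>
  have short: "data_size (data_of_list (rev (map data_of_pair (filter P ys)))) \<le> D"
    if "es = ys @ zs" for P ys zs
  proof -
    have "data_size (data_of_list (rev (map data_of_pair (filter P ys))))
        \<le> data_size (data_of_list (map data_of_pair ys))"
    proof (induction ys)
      case (Cons y ys)
      then show ?case
        using data_size_data_of_list_append[of "rev (map data_of_pair (filter P ys))" "[data_of_pair y]"]
        by auto
    qed simp
    also have "\<dots> \<le> D"
      using D(1) s(1) data_size_data_of_list_append[of "map data_of_pair ys" "map data_of_pair zs"]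
        data_size_pos[of "data_of_list (map data_of_pair zs)"] that by simp
    finally show ?thesis .
  qed
  have "runs edge_loop s 0 (length es * (edge_time D + 1 + D) + 2) (\<lambda>s'.
    (s' 8 = data_of_list (rev (map data_of_pair (filter (both_in A) es))) \<and> s' 3 = s 3) \<and>
    s' 7 = Leaf)"
    unfolding edge_loop_def
  proof (rule runs_While_list[where enc = data_of_pair])
    fix ys x zs and t :: store
    assume split: "es = ys @ x # zs"
      and t: "t 8 = data_of_list (rev (map data_of_pair (filter (both_in A) ys))) \<and> t 3 = s 3"
      and t7: "t 7 = Node (data_of_pair x) (data_of_list (map data_of_pair zs))"
    have "data_size (t 7) \<le> D"
      using data_size_suffix_le[of data_of_pair ys "x # zs" D] D(1) s(1) split t7 by simp
    then have "runs edge_step t 0 (edge_time D) (\<lambda>s'.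
      s' 8 = data_of_list ((if both_in A x then [data_of_pair x] else []) @
        rev (map data_of_pair (filter (both_in A) ys))) \<and>
      s' 3 = t 3 \<and> s' 7 = data_of_list (map data_of_pair zs))"
      by (intro runs_edge_step) (use t t7 s D short[OF split] in auto)
    then show "runs edge_step t 0 (edge_time D) (\<lambda>s'.
      (s' 8 = data_of_list (rev (map data_of_pair (filter (both_in A) (ys @ [x])))) \<and> s' 3 = s 3) \<and>
      s' 7 = data_of_list (map data_of_pair zs))"
      by (rule runs_weaken) (use t in auto)
  qed (use s D in auto)
  then show ?thesis by (rule runs_weaken) (use short[of es "[]"] in auto)
qed

text \<open>The encoding of \<open>Inl (2 * v + 1)\<close> under \<open>rep_sum\<close>. One
  \<open>Tl\<close> drops the tag and a second one the lowest bit, which leaves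
  \<open>v\<close>.\<close>

definition data_of_interdicted :: "nat \<Rightarrow> data" where
  "data_of_interdicted v = Node (data_of_bool False) (data_of_nat (2 * v + 1))"

text \<open>The decoded vertices are pushed in front of the full vertex list in variable 2, so that
  a single greedy pass considers the interdicted vertices first.\<close>

definition decode_loop :: cmd where
  "decode_loop = While (Var 12)
    (Assign 2 (expr.Cons (Tl (Tl (Hd (Var 12)))) (Var 2)) ;; Assign 12 (Tl (Var 12)))"

text \<open>The joint size of variables 2 and 12 never grows, since decoding shortens each entry
  that moves from one to the other; this sum is carried in the invariant of the proof.\<close>

lemma runs_decode_loop:
  assumes s: "s 12 = data_of_list (map data_of_interdicted W)" "s 2 = data_of_list (map data_of_nat vs)"
    and D: "data_size (s 12) \<le> D" "data_size (s 12) + data_size (s 2) \<le> D"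
  shows "runs decode_loop s 0 (length W * (10 * D + 20 + 1 + D) + 2) (\<lambda>s'.
    (s' 2 = data_of_list (map data_of_nat (rev W @ vs)) \<and>
     (\<forall>x. x \<noteq> 2 \<and> x \<noteq> 12 \<longrightarrow> s' x = s x)) \<and> s' 12 = Leaf)"
proof -
  have "runs decode_loop s 0 (length W * (10 * D + 20 + 1 + D) + 2) (\<lambda>s'.
    (s' 2 = data_of_list (map data_of_nat (rev W @ vs)) \<and>
     data_size (s' 2) + data_size (s' 12) \<le> D \<and>
     (\<forall>x. x \<noteq> 2 \<and> x \<noteq> 12 \<longrightarrow> s' x = s x)) \<and> s' 12 = Leaf)"
    unfolding decode_loop_def
  proof (rule runs_While_list[where enc = data_of_interdicted])
    fix ys x zs and t :: store
    assume split: "W = ys @ x # zs"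
      and t: "t 2 = data_of_list (map data_of_nat (rev ys @ vs)) \<and>
        data_size (t 2) + data_size (t 12) \<le> D \<and> (\<forall>x. x \<noteq> 2 \<and> x \<noteq> 12 \<longrightarrow> t x = s x)"
      and t12: "t 12 = Node (data_of_interdicted x) (data_of_list (map data_of_interdicted zs))"
    show "runs (Assign 2 (expr.Cons (Tl (Tl (Hd (Var 12)))) (Var 2)) ;; Assign 12 (Tl (Var 12))) t 0
      (10 * D + 20) (\<lambda>s'.
      (s' 2 = data_of_list (map data_of_nat (rev (ys @ [x]) @ vs)) \<and>
       data_size (s' 2) + data_size (s' 12) \<le> D \<and>
       (\<forall>x. x \<noteq> 2 \<and> x \<noteq> 12 \<longrightarrow> s' x = s x)) \<and>
      s' 12 = data_of_list (map data_of_interdicted zs))"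
      by (intro runs_Seq_Assign runs_Assign)
        (use t t12 in \<open>auto simp: data_of_interdicted_def data_of_bool_def\<close>)
  qed (use s D in auto)
  then show ?thesis by (rule runs_weaken) auto
qed

definition extract_subgraph :: cmd where
  "extract_subgraph = Assign 2 (Hd (Hd (Hd (Var 0)))) ;; Assign 12 (Tl (Var 0)) ;; decode_loop ;;
    pick_loop ;; Assign 7 (Tl (Hd (Hd (Var 0)))) ;; edge_loop ;;
    Assign 0 (expr.Cons (Var 3) (Var 8))"

definition extract_time :: "nat \<Rightarrow> nat" where
  "extract_time D = (D * (10 * D + 20 + 1 + D) + 2) + (D * (pick_time D + 1 + D) + 2) +
    (D * (edge_time D + 1 + D) + 2) + 20 * D + 100"

lemma runs_extract_subgraph:
  assumes x: "x = Node (Node (data_of_list (map data_of_nat vs)) (data_of_list (map data_of_pair es)))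
      (data_of_nat k)"
    and z: "z = data_of_list (map data_of_interdicted W)"
  defines "A \<equiv> foldl (pick k) [] (rev W @ vs)" and "n \<equiv> data_size x + data_size z"
  shows "runs extract_subgraph ((\<lambda>_. Leaf)(0 := Node x z)) 0 (extract_time (n * n + n + 1))
    (\<lambda>s'. s' 0 = Node (data_of_list (map data_of_nat A))
      (data_of_list (rev (map data_of_pair (filter (both_in A) es)))))"
proof -
  \<comment> \<open>\<open>n * n + 1\<close> bounds the list of chosen vertices and
    \<open>n + 1\<close> is the size of the input \<open>Node x z\<close>; \<open>D\<close>
    dominates both.\<close>
  define D where "D = n * n + n + 1"
  have D: "n \<le> D" "1 + n * n \<le> D" "n + 1 \<le> D" by (simp_all add: D_def)
  have size: "data_size (data_of_list (map data_of_nat vs)) +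
      data_size (data_of_list (map data_of_pair es)) + data_size z \<le> n"
    "data_size (Node x z) = n + 1" by (simp_all add: n_def x)
  have len: "length vs + length W \<le> n" "length es \<le> D" "length W \<le> D"
    using size(1) D(1) length_less_data_size[of "map data_of_nat vs"]
      length_less_data_size[of "map data_of_interdicted W"]
      length_less_data_size[of "map data_of_pair es"] by (auto simp: z)
  have small: "data_size (data_of_nat v) < n" if "v \<in> set (rev W @ vs)" for v
  proof -
    have "v \<in> set W \<or> v \<in> set vs" using that by auto
    then show ?thesis
    proof
      assume "v \<in> set W"
      then have "data_size (data_of_interdicted v) < data_size z"
        unfolding z by (intro data_size_element_less) auto
      then show ?thesis using size(1) by (simp add: data_of_interdicted_def)
    next
      assume "v \<in> set vs"
      then have "data_size (data_of_nat v) < data_size (data_of_list (map data_of_nat vs))"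
        by (intro data_size_element_less) auto
      then show ?thesis using size(1) by simp
    qed
  qed
  let ?s0 = "(\<lambda>_. Leaf)(0 := Node x z) :: store"
  have A_size: "data_size (data_of_list (map data_of_nat A)) \<le> D"
  proof -
    have "data_size (data_of_list (map data_of_nat A)) \<le> 1 + length (map data_of_nat A) * n"
      using small set_foldl_pick[of k "[]" "rev W @ vs"]
      by (intro data_size_data_of_list_le) (auto simp: A_def)
    also have "\<dots> \<le> 1 + n * n"
      using length_foldl_pick_le[of k "[]" "rev W @ vs"] len(1)
      by (auto simp: A_def intro!: mult_le_mono1)
    finally show ?thesis using D(2) by simp
  qed
  have times: "length W * (10 * D + 20 + 1 + D) \<le> D * (10 * D + 20 + 1 + D)"
    "length (rev W @ vs) * (pick_time D + 1 + D) \<le> D * (pick_time D + 1 + D)"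
    "length es * (edge_time D + 1 + D) \<le> D * (edge_time D + 1 + D)"
    using len D(1) by (intro mult_le_mono1; simp)+
  have "runs extract_subgraph ?s0 0 (extract_time D)
    (\<lambda>s'. s' 0 = Node (data_of_list (map data_of_nat A))
      (data_of_list (rev (map data_of_pair (filter (both_in A) es)))))"
    unfolding extract_subgraph_def
  proof (intro runs_Seq_Assign, rule runs_Seq[OF runs_decode_loop[where W = W and vs = vs and D = D]],
      goal_cases)
    case (5 t)
    then have t: "t 2 = data_of_list (map data_of_nat (rev W @ vs))" "t 0 = Node x z"
      "t 3 = Leaf" "t 4 = Leaf" "t 7 = Leaf" "t 8 = Leaf" by auto
    show ?case
    proof (rule runs_Seq[OF runs_pick_loop[where L = "rev W @ vs" and k = k and n = n and D = D]],
        goal_cases)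
      case (10 r)
      then have r: "r 3 = data_of_list (map data_of_nat A)" "r 0 = Node x z" "r 8 = Leaf"
        using t by (auto simp: A_def)
      show ?case
      proof (rule runs_Seq_Assign,
          rule runs_Seq[OF runs_edge_loop[where es = es and A = A and D = D]], goal_cases)
        case (6 q)
        then have q: "q 8 = data_of_list (rev (map data_of_pair (filter (both_in A) es)))"
          "data_size (q 8) \<le> D" "q 3 = data_of_list (map data_of_nat A)" using r by auto
        show ?case
        proof (rule runs_Assign, goal_cases)
          case 1
          have "data_size (q 3) \<le> D" using q A_size by simp
          then have "expr_time (expr.Cons (Var 3) (Var 8)) q \<le> 2 * D + 1" using q(2) by simp
          moreover have "expr_time (Hd (Hd (Hd (Var 0)))) ?s0 = n + 4"
            "expr_time (Tl (Var 0)) (?s0(2 := expr_val (Hd (Hd (Hd (Var 0)))) ?s0)) = n + 2"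
            "expr_time (Tl (Hd (Hd (Var 0)))) r = n + 4"
            using size(2) r(2) by simp_all
          ultimately show ?case using times D(3) unfolding extract_time_def by linarith
        next
          case 2
          show ?case using q by simp
        qed
      qed (use r A_size size D(1) in \<open>auto simp: x\<close>)
    qed (use t small len size D in \<open>auto simp: x\<close>)
  qed (use size D(1) z in \<open>auto simp: x\<close>)
  then show ?thesis by (simp add: D_def)
qed

section \<open>Representations\<close>

definition ends_of :: "nat \<times> nat \<Rightarrow> nat set" where
  "ends_of p = {fst p, snd p}"

lemma list_all2_rep_nat: "list_all2 rep_nat xs vs \<longleftrightarrow> xs = map data_of_nat vs"
  by (induction vs arbitrary: xs) (auto simp: rep_nat_def list_all2_Cons2)

lemma rep_set_nat_iff:
  "rep_set rep_nat x A \<longleftrightarrow> (\<exists>vs. distinct vs \<and> set vs = A \<and> x = data_of_list (map data_of_nat vs))"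
  by (auto simp: rep_set_def list_all2_rep_nat)

lemma rep_edge_iff: "rep_edge x e \<longleftrightarrow> (\<exists>p. e = ends_of p \<and> x = data_of_pair p)"
  by (auto simp: rep_edge_def rep_prod_def rep_nat_def ends_of_def data_of_pair_def)

text \<open>An edge can be written with its ends in either order, so its encoding is not a function
  of the edge; \<open>ps\<close> records the orientations that occur in the input.\<close>

lemma list_all2_rep_edge:
  "list_all2 rep_edge xs es \<longleftrightarrow> (\<exists>ps. es = map ends_of ps \<and> xs = map data_of_pair ps)"
proof
  show "list_all2 rep_edge xs es \<Longrightarrow> \<exists>ps. es = map ends_of ps \<and> xs = map data_of_pair ps"
  proof (induction rule: list_all2_induct)
    case (Cons x xs e es)
    then obtain p ps where "e = ends_of p" "x = data_of_pair p"
      "es = map ends_of ps" "xs = map data_of_pair ps" by (auto simp: rep_edge_iff)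
    then show ?case by (intro exI[of _ "p # ps"]) simp
  qed simp
  show "\<exists>ps. es = map ends_of ps \<and> xs = map data_of_pair ps \<Longrightarrow> list_all2 rep_edge xs es"
  proof -
    have "rep_edge (data_of_pair p) (ends_of p)" for p unfolding rep_edge_iff by blast
    moreover assume "\<exists>ps. es = map ends_of ps \<and> xs = map data_of_pair ps"
    ultimately show ?thesis by (auto simp: list_all2_map1 list_all2_map2 list_all2_same)
  qed
qed

text \<open>Distinctness is required of the edges rather than of the pairs: distinct pairs could be
  two orientations of one edge.\<close>

lemma rep_set_edge_iff:
  "rep_set rep_edge x E \<longleftrightarrow> (\<exists>ps. distinct (map ends_of ps) \<and> ends_of ` set ps = E \<and>
    x = data_of_list (map data_of_pair ps))"
proof
  assume "rep_set rep_edge x E"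
  then obtain ps where "distinct (map ends_of ps)" "set (map ends_of ps) = E"
    "x = data_of_list (map data_of_pair ps)"
    unfolding rep_set_def list_all2_rep_edge by blast
  then show "\<exists>ps. distinct (map ends_of ps) \<and> ends_of ` set ps = E \<and>
    x = data_of_list (map data_of_pair ps)" by (intro exI[of _ ps]) simp
next
  assume "\<exists>ps. distinct (map ends_of ps) \<and> ends_of ` set ps = E \<and>
    x = data_of_list (map data_of_pair ps)"
  then obtain ps where "distinct (map ends_of ps)" "set (map ends_of ps) = E"
    "x = data_of_list (map data_of_pair ps)" by auto
  then show "rep_set rep_edge x E" unfolding rep_set_def list_all2_rep_edge by blast
qed

lemma rep_setI:
  assumes "distinct as" "set as = A" "list_all2 R xs as"
  shows "rep_set R (data_of_list xs) A"
  using assms by (auto simp: rep_set_def)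

text \<open>The name of an edge is determined by its position in the input listing. The exponent is
  shifted by one to match the names that \<open>source_loop\<close> produces, which also makes it
  even.\<close>

definition edge_code :: "(nat \<times> nat) list \<Rightarrow> nat set \<Rightarrow> nat" where
  "edge_code es e = 2 ^ (the_inv_into {..<length es} (\<lambda>i. ends_of (es ! i)) e + 1)"

lemma edge_code_nth:
  assumes "distinct (map ends_of es)" "i < length es"
  shows "edge_code es (ends_of (es ! i)) = 2 ^ (i + 1)"
proof -
  have "inj_on (\<lambda>i. ends_of (es ! i)) {..<length es}"
    using assms(1) by (auto simp: inj_on_def distinct_conv_nth)
  from the_inv_into_f_f[OF this, of i] show ?thesis using assms(2) by (simp add: edge_code_def)
qed

lemma image_set_nth: "f ` set es = (\<lambda>i. f (es ! i)) ` {0..<length es}"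
proof -
  have "f ` set es = f ` set (map (\<lambda>i. es ! i) [0..<length es])" by (simp only: map_nth)
  then show ?thesis by (simp add: image_image)
qed

lemma edge_coding_edge_code:
  assumes "simple_graph G" "distinct (map ends_of es)" "ends_of ` set es = snd G"
  shows "edge_coding G (edge_code es)"
proof
  show "simple_graph G" by fact
  have E: "\<exists>i < length es. e = ends_of (es ! i)" if "e \<in> snd G" for e
    using that unfolding assms(3)[symmetric] by (metis imageE in_set_conv_nth)
  show "inj_on (edge_code es) (snd G)"
  proof (rule inj_onI)
    fix e e' assume "e \<in> snd G" "e' \<in> snd G" and eq: "edge_code es e = edge_code es e'"
    then obtain i j where "i < length es" "e = ends_of (es ! i)" "j < length es" "e' = ends_of (es ! j)"
      using E by metis
    then show "e = e'" using eq edge_code_nth[OF assms(2)] by simp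
  qed
  show "even (edge_code es e)" for e by (simp add: edge_code_def)
qed

lemma set_arc_list:
  "set (concat (map (\<lambda>i. [f i (fst (es ! i)), f i (snd (es ! i))]) (rev [0..<m]))) =
    {f i u | i u. i < m \<and> u \<in> ends_of (es ! i)}"
  by (induction m) (auto simp: ends_of_def less_Suc_eq)

lemma distinct_arc_list:
  assumes "\<And>i. i < m \<Longrightarrow> fst (es ! i) \<noteq> snd (es ! i)"
    and inj: "\<And>i j u v. f i u = f j v \<Longrightarrow> i = j \<and> u = v"
  shows "distinct (concat (map (\<lambda>i. [f i (fst (es ! i)), f i (snd (es ! i))]) (rev [0..<m])))"
  using assms(1)
proof (induction m)
  case (Suc m)
  let ?L = "concat (map (\<lambda>i. [f i (fst (es ! i)), f i (snd (es ! i))]) (rev [0..<m]))"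
  have "f m u \<notin> set ?L" for u
  proof
    assume "f m u \<in> set ?L"
    then obtain i v where "f m u = f i v" "i < m" unfolding set_arc_list by auto
    then show False using inj by blast
  qed
  moreover have "f m (fst (es ! m)) \<noteq> f m (snd (es ! m))" using Suc.prems inj by blast
  ultimately show ?case using Suc by simp
qed simp

lemma list_all2_concat_pairs:
  assumes "\<And>i. i \<in> set is \<Longrightarrow> R (a i) (b i) \<and> R (c i) (d i)"
  shows "list_all2 R (concat (map (\<lambda>i. [a i, c i]) is)) (concat (map (\<lambda>i. [b i, d i]) is))"
  using assms by (induction "is") auto

text \<open>Representations admit any duplicate-free listing, so the order in which the program
  emits its tables is immaterial. It remains to match the entries and to verify that no row occurs
  twice.\<close>

lemma rep_network_data:
  assumes G: "simple_graph G" and vs: "distinct vs" "set vs = fst G"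
    and es: "distinct (map ends_of es)" "ends_of ` set es = snd G"
  shows "rep_network (network_data vs es) (subdivision_network (edge_code es) G)"
proof -
  let ?N = "subdivision_network (edge_code es) G"
  let ?m = "length es"
  let ?c = "\<lambda>i. 2 ^ (i + 1) :: nat"
  have code: "edge_code es ` snd G = ?c ` {0..<?m}"
    unfolding es(2)[symmetric] image_image image_set_nth[of "\<lambda>p. edge_code es (ends_of p)"]
    using edge_code_nth[OF es(1)] by (intro image_cong) auto
  have arcs: "arcs ?N = {(?c i, 2 * u + 1) | i u. i < ?m \<and> u \<in> ends_of (es ! i)}"
  proof -
    have "arcs ?N = {(edge_code es (ends_of (es ! i)), 2 * u + 1) | i u. i < ?m \<and> u \<in> ends_of (es ! i)}"
    proof -
      have "e \<in> snd G \<longleftrightarrow> (\<exists>i < ?m. e = ends_of (es ! i))" for e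
        unfolding es(2)[symmetric] by (metis imageE imageI in_set_conv_nth)
      then show ?thesis unfolding subdivision_network_def by auto
    qed
    then show ?thesis using edge_code_nth[OF es(1)] by auto
  qed
  \<comment> \<open>Equal ends would make the two arc rows of an edge coincide and spoil the
    distinctness of the listing.\<close>
  have loopless: "fst (es ! i) \<noteq> snd (es ! i)" if "i < ?m" for i
  proof -
    have "card (ends_of (es ! i)) = 2" using that G es(2) by (auto simp: simple_graph_def)
    then show ?thesis by (auto simp: ends_of_def)
  qed
  have inj_c: "inj ?c" by (auto simp: inj_def)
  have "rep_set (rep_prod rep_nat (rep_prod rep_enat rep_ext_int))
    (data_of_list (rev (map source_entry [0..<?m]) @ rev (map sink_entry vs)))
    ((\<lambda>v. (v, cost ?N (Inl v), dem ?N v)) ` verts ?N)"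
  proof (rule rep_setI)
    let ?f = "\<lambda>v. (v, cost ?N (Inl v), dem ?N v)"
    let ?as = "rev (map (\<lambda>i. ?f (?c i)) [0..<?m]) @ rev (map (\<lambda>v. ?f (2 * v + 1)) vs)"
    have neq: "?c i \<noteq> 2 * v + 1" for i v
    proof -
      have "even (?c i)" "odd (2 * v + 1)" by simp_all
      then show ?thesis by metis
    qed
    have "distinct (map (\<lambda>i. ?f (?c i)) [0..<?m])" "distinct (map (\<lambda>v. ?f (2 * v + 1)) vs)"
      using vs(1) inj_c by (simp_all add: distinct_map inj_on_def)
    moreover have "set (map (\<lambda>i. ?f (?c i)) [0..<?m]) \<inter> set (map (\<lambda>v. ?f (2 * v + 1)) vs) = {}"
      using neq by auto
    ultimately show "distinct ?as" by (simp del: set_map)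
    show "set ?as = ?f ` verts ?N"
      using code vs(2) by (auto simp: subdivision_network_def image_Un image_image)
    show "list_all2 (rep_prod rep_nat (rep_prod rep_enat rep_ext_int))
        (rev (map source_entry [0..<?m]) @ rev (map sink_entry vs)) ?as"
    proof (intro list_all2_appendI)
      have "rep_prod rep_nat (rep_prod rep_enat rep_ext_int) (source_entry i) (?f (?c i))" for i
        by (simp add: rep_prod_def rep_nat_def rep_int_def source_entry_def subdivision_network_def)
      then show "list_all2 (rep_prod rep_nat (rep_prod rep_enat rep_ext_int))
          (rev (map source_entry [0..<?m])) (rev (map (\<lambda>i. ?f (?c i)) [0..<?m]))"
        unfolding list_all2_rev by (simp add: list_all2_map1 list_all2_map2 list_all2_same)
      have "rep_prod rep_nat (rep_prod rep_enat rep_ext_int) (sink_entry v) (?f (2 * v + 1))" for v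
        by (simp add: rep_prod_def rep_nat_def one_enat_def sink_entry_def subdivision_network_def)
      then show "list_all2 (rep_prod rep_nat (rep_prod rep_enat rep_ext_int))
          (rev (map sink_entry vs)) (rev (map (\<lambda>v. ?f (2 * v + 1)) vs))"
        unfolding list_all2_rev by (simp add: list_all2_map1 list_all2_map2 list_all2_same)
    qed
  qed
  moreover have "rep_set (rep_prod (rep_prod rep_nat rep_nat) (rep_prod rep_nat rep_enat))
    (data_of_list (arc_entries es ?m)) ((\<lambda>e. (e, cap ?N e, cost ?N (Inr e))) ` arcs ?N)"
  proof (rule rep_setI)
    let ?f = "\<lambda>i u. ((?c i, 2 * u + 1), 1 :: nat, \<infinity> :: enat)"
    let ?as = "concat (map (\<lambda>i. [?f i (fst (es ! i)), ?f i (snd (es ! i))]) (rev [0..<?m]))"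
    show "distinct ?as"
      by (rule distinct_arc_list) (use loopless in auto)
    have "set ?as = {?f i u | i u. i < ?m \<and> u \<in> ends_of (es ! i)}" by (rule set_arc_list)
    also have "\<dots> = (\<lambda>e. (e, cap ?N e, cost ?N (Inr e))) ` arcs ?N"
      unfolding arcs by (auto simp: subdivision_network_def image_iff)
    finally show "set ?as = (\<lambda>e. (e, cap ?N e, cost ?N (Inr e))) ` arcs ?N" .
    show "list_all2 (rep_prod (rep_prod rep_nat rep_nat) (rep_prod rep_nat rep_enat))
        (arc_entries es ?m) ?as"
      unfolding arc_entries_def
      by (rule list_all2_concat_pairs) (auto simp: arc_entry_def rep_prod_def rep_nat_def)
  qed
  moreover have "rep_set rep_nat
    (data_of_list (rev (map (\<lambda>i. data_of_nat (2 ^ (i + 1))) [0..<?m]))) (sources ?N)"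
    unfolding rep_set_nat_iff
    using code inj_c
    by (intro exI[of _ "rev (map ?c [0..<?m])"])
      (auto simp: subdivision_network_def rev_map distinct_map inj_on_def comp_def)
  moreover have "rep_set rep_nat
    (data_of_list (rev (map (\<lambda>v. data_of_nat (2 * v + 1)) vs))) (sinks ?N)"
    unfolding rep_set_nat_iff
    using vs
    by (intro exI[of _ "rev (map (\<lambda>v. 2 * v + 1) vs)"])
      (auto simp: subdivision_network_def rev_map distinct_map inj_on_def comp_def)
  ultimately show ?thesis
    unfolding rep_network_def network_data_def by (simp add: rep_prod_def)
qed

text \<open>The reduction has to cope with every representation of a solution, hence with an
  arbitrary listing of the interdicted sinks. All its entries are names of sinks, so it can be
  pulled back to a listing of \<open>U\<close>.\<close>

lemma rep_interdict_verts:
  assumes "rep_set (rep_sum rep_nat (rep_prod rep_nat rep_nat)) z (interdict_verts U)"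
  obtains W where "distinct W" "set W = U" "z = data_of_list (map data_of_interdicted W)"
proof -
  obtain rs zs where rs: "distinct rs" "set rs = interdict_verts U"
    "list_all2 (rep_sum rep_nat (rep_prod rep_nat rep_nat)) zs rs" "z = data_of_list zs"
    using assms by (auto simp: rep_set_def)
  define h :: "nat \<Rightarrow> nat + arc" where "h v = Inl (2 * v + 1)" for v
  have inj_h: "inj h" by (auto simp: inj_def h_def)
  have "rs \<in> lists (range h)" using rs(2) by (auto simp: h_def interdict_verts_def)
  then obtain W where W: "rs = map h W" by (auto simp: lists_image)
  have "distinct W" using rs(1) W by (simp add: distinct_map)
  moreover have "set W = U"
  proof -
    have "h ` set W = h ` U" using rs(2) W by (simp add: h_def interdict_verts_def)
    then show ?thesis using inj_h by (simp add: inj_image_eq_iff)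
  qed
  moreover have "zs = map data_of_interdicted W"
    using rs(3) unfolding W
    by (induction W arbitrary: zs)
      (auto simp: list_all2_Cons2 h_def rep_nat_def data_of_interdicted_def)
  ultimately show ?thesis using that rs(4) by blast
qed

section \<open>The reduction\<close>

text \<open>Closure under sums and products lets the time bounds be recognised as polynomials from
  their syntax, without computing coefficients.\<close>

definition polynomial_fun :: "(nat \<Rightarrow> nat) \<Rightarrow> bool" where
  "polynomial_fun f \<longleftrightarrow> (\<exists>p :: nat poly. \<forall>n. poly p n = f n)"

lemma polynomial_fun_const: "polynomial_fun (\<lambda>_. c)"
  unfolding polynomial_fun_def by (rule exI[of _ "[:c:]"]) simp

lemma polynomial_fun_id: "polynomial_fun (\<lambda>n. n)"
  unfolding polynomial_fun_def by (rule exI[of _ "[:0, 1:]"]) simp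

lemma polynomial_fun_add:
  "polynomial_fun f \<Longrightarrow> polynomial_fun g \<Longrightarrow> polynomial_fun (\<lambda>n. f n + g n)"
  unfolding polynomial_fun_def by (metis poly_add)

lemma polynomial_fun_mult:
  "polynomial_fun f \<Longrightarrow> polynomial_fun g \<Longrightarrow> polynomial_fun (\<lambda>n. f n * g n)"
  unfolding polynomial_fun_def by (metis poly_mult)

lemmas polynomial_fun_intros =
  polynomial_fun_const polynomial_fun_id polynomial_fun_add polynomial_fun_mult

text \<open>The bound of \<open>runs_build_network\<close> with \<open>K\<close> expanded, which
  makes it a function of the input size alone.\<close>

definition build_time :: "nat \<Rightarrow> nat" where
  "build_time n = n * (20 * (1 + n * (6 * n + 100)) + 10 * (6 * n + 100) + 1 + n)
    + n * (20 * (1 + n * (6 * n + 100)) + 10 * (6 * n + 100) + 1 + n)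
    + 20 * (1 + n * (6 * n + 100)) + 100 * (6 * n + 100)"

lemma polynomial_fun_build_time: "polynomial_fun (\<lambda>n. build_time n)"
  unfolding build_time_def by (intro polynomial_fun_intros)

lemma polynomial_fun_extract_time: "polynomial_fun (\<lambda>n. extract_time (n * n + n + 1))"
  unfolding extract_time_def by (intro polynomial_fun_intros)

lemma computes_in_of_runs:
  assumes "runs c ((\<lambda>_. Leaf)(0 := x)) 0 T (\<lambda>s. s 0 = y)"
  shows "\<exists>t. computes_in c x t y \<and> t \<le> T"
  using assms by (auto simp: runs_def computes_in_def)

theorem theorem3:
  shows "\<exists>q :: nat poly.
    poly_time_reducible planar_densest_subgraph_problem (planar_interdiction_problem q)"
proof -
  \<comment> \<open>One polynomial has to serve both programs; with natural coefficients the sum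
    \<open>p1 + p2\<close> dominates each summand.\<close>
  obtain p1 p2 :: "nat poly" where
    p: "\<And>n. poly p1 n = build_time n" "\<And>n. poly p2 n = extract_time (n * n + n + 1)"
    using polynomial_fun_build_time polynomial_fun_extract_time unfolding polynomial_fun_def by metis
  \<comment> \<open>Solvability of the target instance is asserted outright, which yields the
    required implication from solvability of the source.\<close>
  have reduction: "\<exists>y t. computes_in build_network x t y \<and> t \<le> poly (p1 + p2) (data_size x) \<and>
      (\<exists>j \<in> instances (planar_interdiction_problem [:1, 1:]).
        rep_instance (planar_interdiction_problem [:1, 1:]) y j \<and>
        (\<exists>s. solves (planar_interdiction_problem [:1, 1:]) j s) \<and>
        (\<forall>s z. solves (planar_interdiction_problem [:1, 1:]) j s \<and>
            rep_solution (planar_interdiction_problem [:1, 1:]) z s \<longrightarrow>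
          (\<exists>w t'. computes_in extract_subgraph (Node x z) t' w \<and>
            t' \<le> poly (p1 + p2) (data_size x + data_size z) \<and>
            (\<exists>r. densest_subgraph G k r \<and> rep_ugraph w r))))"
    if G: "simple_graph G" "planar G" "k \<le> card (fst G)" and x: "rep_prod rep_ugraph rep_nat x (G, k)"
    for G k x
  proof -
    obtain vs es where vs: "distinct vs" "set vs = fst G"
      and es: "distinct (map ends_of es)" "ends_of ` set es = snd G"
      and x_eq: "x = Node (Node (data_of_list (map data_of_nat vs)) (data_of_list (map data_of_pair es)))
        (data_of_nat k)"
      using x by (auto simp: rep_prod_def rep_ugraph_def rep_set_nat_iff rep_set_edge_iff rep_nat_def)
    interpret edge_coding G "edge_code es"
      by (rule edge_coding_edge_code[OF G(1) es])
    have "runs build_network ((\<lambda>_. Leaf)(0 := x)) 0 (build_time (data_size x))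
        (\<lambda>s. s 0 = Node (network_data vs es) (data_of_nat k))"
      using runs_build_network[OF x_eq] unfolding build_time_def .
    then obtain t where t: "computes_in build_network x t (Node (network_data vs es) (data_of_nat k))"
      "t \<le> build_time (data_size x)"
      using computes_in_of_runs by blast
    have recover: "\<exists>w t'. computes_in extract_subgraph (Node x z) t' w \<and>
        t' \<le> extract_time ((data_size x + data_size z) * (data_size x + data_size z)
          + (data_size x + data_size z) + 1) \<and>
        (\<exists>r. densest_subgraph G k r \<and> rep_ugraph w r)"
      if R: "optimal_interdiction_set N k R"
        "rep_set (rep_sum rep_nat (rep_prod rep_nat rep_nat)) z R" for R z
    proof -
      obtain U where U: "U \<subseteq> fst G" "card U \<le> k" "R = interdict_verts U"
        using R(1) by (auto simp: optimal_interdiction_set_def interdiction_set_iff)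
      obtain W where W: "distinct W" "set W = U" "z = data_of_list (map data_of_interdicted W)"
        using rep_interdict_verts R(2) U(3) by blast
      \<comment> \<open>This is the vertex list that \<open>extract_subgraph\<close> computes;
        \<open>W\<close> appears reversed because \<open>decode_loop\<close> conses its elements one
        by one.\<close>
      define A where "A = foldl (pick k) [] (rev W @ vs)"
      have A: "U \<subseteq> set A" "set A \<subseteq> fst G" "card (set A) = k" "distinct A"
        using foldl_pick_extends[of "rev W" k vs] W U vs G(3) distinct_card[OF W(1)]
        by (auto simp: A_def)
      have "densest_subgraph G k (set A, induced_edges G (set A))"
        using densest_subgraph_of_optimal R(1) U A by blast
      moreover have "rep_ugraph (Node (data_of_list (map data_of_nat A))
          (data_of_list (rev (map data_of_pair (filter (both_in A) es))))) (set A, induced_edges G (set A))"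
      proof -
        have "rep_set rep_nat (data_of_list (map data_of_nat A)) (set A)"
          using A(4) by (auto simp: rep_set_nat_iff)
        moreover have "rep_set rep_edge (data_of_list (rev (map data_of_pair (filter (both_in A) es))))
            (induced_edges G (set A))"
          unfolding rep_set_edge_iff
        proof (intro exI[of _ "rev (filter (both_in A) es)"] conjI)
          show "distinct (map ends_of (rev (filter (both_in A) es)))"
            using es(1) by (simp add: rev_map[symmetric] distinct_map_filter)
          show "ends_of ` set (rev (filter (both_in A) es)) = induced_edges G (set A)"
            unfolding induced_edges_def es(2)[symmetric]
            by (auto simp: both_in_def ends_of_def)
        qed (simp add: rev_map)
        ultimately show ?thesis by (simp add: rep_ugraph_def rep_prod_def)
      qed
      moreover note computes_in_of_runs[OF runs_extract_subgraph[OF x_eq W(3), folded A_def]]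
      ultimately show ?thesis by blast
    qed
    have "(N, k) \<in> instances (planar_interdiction_problem [:1, 1:])"
      using interdiction_network_subdivision planar_subdivision[OF G(2)]
        numbers_bounded_subdivision[OF G(3)]
      by (simp add: planar_interdiction_problem_def)
    moreover have "rep_instance (planar_interdiction_problem [:1, 1:])
        (Node (network_data vs es) (data_of_nat k)) (N, k)"
      using rep_network_data[OF G(1) vs es]
      by (simp add: planar_interdiction_problem_def rep_prod_def rep_nat_def)
    moreover have "\<exists>s. solves (planar_interdiction_problem [:1, 1:]) (N, k) s"
      using optimal_interdiction_set_exists by (simp add: planar_interdiction_problem_def)
    moreover have "\<exists>w t'. computes_in extract_subgraph (Node x z) t' w \<and>
        t' \<le> poly (p1 + p2) (data_size x + data_size z) \<and>
        (\<exists>r. densest_subgraph G k r \<and> rep_ugraph w r)"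
      if "solves (planar_interdiction_problem [:1, 1:]) (N, k) s \<and>
        rep_solution (planar_interdiction_problem [:1, 1:]) z s" for s z
      using recover[of s z] that unfolding poly_add p
      by (auto simp: planar_interdiction_problem_def intro: trans_le_add2)
    moreover have "t \<le> poly (p1 + p2) (data_size x)" using t(2) unfolding poly_add p by simp
    ultimately show ?thesis using t(1) by blast
  qed
  show ?thesis
    unfolding poly_time_reducible_def
  proof (rule exI[of _ "[:1, 1:]"], rule exI[of _ build_network], rule exI[of _ extract_subgraph],
      rule exI[of _ "p1 + p2"], intro ballI allI impI, goal_cases)
    case (1 i x)
    obtain G k where i: "i = (G, k)" by (cases i)
    have "simple_graph G" "planar G" "k \<le> card (fst G)" "rep_prod rep_ugraph rep_nat x (G, k)"
      using 1 by (auto simp: i planar_densest_subgraph_problem_def)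
    moreover have "solves planar_densest_subgraph_problem i = densest_subgraph G k"
      "rep_solution planar_densest_subgraph_problem = rep_ugraph"
      by (simp_all add: i planar_densest_subgraph_problem_def)
    ultimately show ?case using reduction by metis
  qed
qed

end
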